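(* Let $\mathcal{O}_2\subseteq(0,\pi)$ be an open set. Then the control system $$\begin{cases}\partial_t\rho+\rho_s\partial_x u=0 & \text{in }(0,T)\times(0,\pi),\\ \partial_t u+a\gamma\rho_s^{\gamma-2}\partial_x\rho-\frac1{\rho_s}\partial_x S=\mathbf{1}_{\mathcal{O}_2}f_2 & \text{in }(0,T)\times(0,\pi),\\ \partial_t S+\frac1\kappa S-\frac\mu\kappa\partial_x u=0 & \text{in }(0,T)\times(0,\pi),\\ u(t,0)=u(t,\pi)=0 & t\in(0,T),\\ \rho(0)=\rho_0,\ u(0)=u_0,\ S(0)=S_0 & \text{in }(0,\pi)\end{cases}$$ is not null controllable in $L^2_m(0,\pi)\times L^2(0,\pi)\times L^2_m(0,\pi)$ at any time $T>0$ by an interior control $f_2\in L^2(0,T;L^2(0,\pi))$ supported in $\mathcal{O}_2$, acting only in the velocity equation.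
   Context: The constants satisfy $a>0$, $\gamma\ge1$, $\rho_s>0$, $\mu>0$, $\kappa>0$. $\mathbf 1_{\mathcal{O}}$ is the characteristic function of $\mathcal{O}$; function spaces are complex-valued. $L^2_m(0,\pi)=\{f\in L^2(0,\pi):\int_0^\pi f\,dx=0\}$. Put $b=a\gamma\rho_s^{\gamma-2}$. Solutions are understood as mild solutions $z=(\rho,u,S)^\top\in C([0,T];(L^2(0,\pi))^3)$ of $\dot z=\mathcal{A}z+(0,\mathbf 1_{\mathcal{O}_2}f_2,0)^\top$, where $\mathcal{A}(\rho,u,S)^\top=(-\rho_s u',\,-b\rho'+\frac1{\rho_s}S',\,\frac\mu\kappa u'-\frac1\kappa S)^\top$ with domain $\{(\rho,u,S)\in(L^2(0,\pi))^3: u\in H^1_0(0,\pi),\ -b\rho+\frac1{\rho_s}S\in H^1(0,\pi)\}$ ($\mathcal{A}$ generates a strongly continuous semigroup on $(L^2(0,\pi))^3$). Null controllability in a subspace $X\subset(L^2(0,\pi))^3$ at time $T$ means: for every $(\rho_0,u_0,S_0)^\top\in X$ there exists a control $f_2\in L^2(0,T;L^2(\mathcal{O}_2))$ such that the corresponding solution satisfies $(\rho,u,S)^\top(T,\cdot)=(0,0,0)^\top$ in $(0,\pi)$. *)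

theory Defs
  imports "HOL-Analysis.Analysis"
begin

abbreviation I_pi :: "real measure" where
  "I_pi \<equiv> lebesgue_on {0<..<pi}"

definition sq_integrable :: "(real \<Rightarrow> complex) \<Rightarrow> bool" where
  "sq_integrable f \<longleftrightarrow> f \<in> borel_measurable I_pi \<and> integrable I_pi (\<lambda>x. (cmod (f x))\<^sup>2)"

lemma sq_integrableD:
  assumes "sq_integrable f"
  shows "f \<in> borel_measurable I_pi" "integrable I_pi (\<lambda>x. (cmod (f x))\<^sup>2)"
  using assms by (auto simp: sq_integrable_def)

lemma sq_integrable_zero: "sq_integrable (\<lambda>x. 0)"
  by (simp add: sq_integrable_def)

lemma sq_integrable_bound:
  assumes "g \<in> borel_measurable I_pi" "integrable I_pi h" "AE x in I_pi. (cmod (g x))\<^sup>2 \<le> h x"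
  shows "sq_integrable g"
  unfolding sq_integrable_def
proof
  show "integrable I_pi (\<lambda>x. (cmod (g x))\<^sup>2)"
  proof (rule Bochner_Integration.integrable_bound[OF assms(2)])
    show "AE x in I_pi. norm ((cmod (g x))\<^sup>2) \<le> norm (h x)"
      using assms(3) by eventually_elim auto
  qed (use assms(1) in measurable)
qed fact

lemma sq_integrable_add:
  assumes "sq_integrable f" "sq_integrable g"
  shows "sq_integrable (\<lambda>x. f x + g x)"
proof (rule sq_integrable_bound)
  show "integrable I_pi (\<lambda>x. 2 * (cmod (f x))\<^sup>2 + 2 * (cmod (g x))\<^sup>2)"
    using assms by (auto simp: sq_integrable_def)
  show "AE x in I_pi. (cmod (f x + g x))\<^sup>2 \<le> 2 * (cmod (f x))\<^sup>2 + 2 * (cmod (g x))\<^sup>2"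
  proof (rule AE_I2)
    fix x
    have "(cmod (f x + g x))\<^sup>2 \<le> (cmod (f x) + cmod (g x))\<^sup>2"
      by (intro power_mono norm_triangle_ineq) auto
    also have "\<dots> \<le> 2 * (cmod (f x))\<^sup>2 + 2 * (cmod (g x))\<^sup>2"
      using sum_squares_bound[of "cmod (f x)" "cmod (g x)"] by (simp add: power2_sum)
    finally show "(cmod (f x + g x))\<^sup>2 \<le> 2 * (cmod (f x))\<^sup>2 + 2 * (cmod (g x))\<^sup>2" .
  qed
qed (use assms in \<open>auto simp: sq_integrable_def\<close>)

lemma sq_integrable_mult:
  assumes "sq_integrable f"
  shows "sq_integrable (\<lambda>x. c * f x)"
  using assms by (auto simp: sq_integrable_def norm_mult power_mult_distrib)

lemma sq_integrable_scaleR: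
  assumes "sq_integrable f"
  shows "sq_integrable (\<lambda>x. r *\<^sub>R f x)"
  using sq_integrable_mult[OF assms, of "of_real r"] by (simp add: scaleR_conv_of_real)

lemma sq_integrable_uminus:
  assumes "sq_integrable f"
  shows "sq_integrable (\<lambda>x. - f x)"
  using sq_integrable_mult[OF assms, of "- 1"] by simp

lemma sq_integrable_diff:
  assumes "sq_integrable f" "sq_integrable g"
  shows "sq_integrable (\<lambda>x. f x - g x)"
  using sq_integrable_add[OF assms(1) sq_integrable_uminus[OF assms(2)]] by simp

lemma sq_integrable_indicator_mult:
  assumes "sq_integrable f" "A \<in> sets lebesgue"
  shows "sq_integrable (\<lambda>x. indicator A x * f x)"
proof (rule sq_integrable_bound)
  show "integrable I_pi (\<lambda>x. (cmod (f x))\<^sup>2)"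
    using assms by (auto simp: sq_integrable_def)
  have "(indicator A :: real \<Rightarrow> complex) \<in> borel_measurable I_pi"
    using assms(2) by (intro measurable_restrict_space1) auto
  then show "(\<lambda>x. indicator A x * f x) \<in> borel_measurable I_pi"
    using assms(1) by (auto simp: sq_integrable_def)
qed (auto simp: indicator_def)

lemma integrable_cnj_product:
  assumes "sq_integrable f" "sq_integrable g"
  shows "integrable I_pi (\<lambda>x. f x * cnj (g x))"
proof (rule Bochner_Integration.integrable_bound)
  show "integrable I_pi (\<lambda>x. (cmod (f x))\<^sup>2 + (cmod (g x))\<^sup>2)"
    using assms by (auto simp: sq_integrable_def)
  show "(\<lambda>x. f x * cnj (g x)) \<in> borel_measurable I_pi"
    using assms by (auto simp: sq_integrable_def intro!: borel_measurable_times
       borel_measurable_continuous_on[OF continuous_on_cnj[OF continuous_on_id]])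
  show "AE x in I_pi. norm (f x * cnj (g x)) \<le> norm ((cmod (f x))\<^sup>2 + (cmod (g x))\<^sup>2)"
  proof (rule AE_I2)
    fix x
    have "2 * (cmod (f x) * cmod (g x)) \<le> (cmod (f x))\<^sup>2 + (cmod (g x))\<^sup>2"
      using sum_squares_bound[of "cmod (f x)" "cmod (g x)"] by simp
    moreover have "0 \<le> cmod (f x) * cmod (g x)" by simp
    ultimately show "norm (f x * cnj (g x)) \<le> norm ((cmod (f x))\<^sup>2 + (cmod (g x))\<^sup>2)"
      unfolding norm_mult complex_mod_cnj real_norm_def by linarith
  qed
qed

text \<open>
  The complex space \<open>L\<^sup>2(0,\<pi>)\<close> as a type: square integrable functions modulo equality almost
  everywhere.  The instances below make it a separable Banach space with the real inner
  product \<open>Re (\<integral> f g\<^sup>* dx)\<close>, whose norm is the usual \<open>L\<^sup>2\<close> norm; separability is what makes the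
  Bochner integral of the library available for functions with values in this space.
\<close>

quotient_type L2 = "real \<Rightarrow> complex" / partial:
  "\<lambda>f g. sq_integrable f \<and> sq_integrable g \<and> (AE x in I_pi. f x = g x)"
  morphisms fun_of to_L2
proof (rule part_equivpI)
  show "\<exists>f. sq_integrable f \<and> sq_integrable f \<and> (AE x in I_pi. f x = f x)"
    using sq_integrable_zero by auto
  show "symp (\<lambda>f g. sq_integrable f \<and> sq_integrable g \<and> (AE x in I_pi. f x = g x))"
    by (auto simp: symp_def elim: eventually_mono)
  show "transp (\<lambda>f g. sq_integrable f \<and> sq_integrable g \<and> (AE x in I_pi. f x = g x))"
    by (auto simp: transp_def elim: eventually_elim2)
qed

lemma to_L2_eq_iff:
  "sq_integrable f \<Longrightarrow> sq_integrable g \<Longrightarrow> to_L2 f = to_L2 g \<longleftrightarrow> (AE x in I_pi. f x = g x)"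
  using Quotient_rel[OF Quotient_L2, of f g] by auto

lemma sq_integrable_fun_of: "sq_integrable (fun_of u)"
  using Quotient_rep_reflp[OF Quotient_L2, of u] by simp

lemma to_L2_fun_of: "to_L2 (fun_of u) = u"
  using Quotient_abs_rep[OF Quotient_L2] .

lemma fun_of_to_L2: "sq_integrable f \<Longrightarrow> AE x in I_pi. fun_of (to_L2 f) x = f x"
  by (subst to_L2_eq_iff[symmetric]) (simp_all add: sq_integrable_fun_of to_L2_fun_of)

lemma L2_cases: obtains f where "u = to_L2 f" "sq_integrable f"
  using to_L2_fun_of[of u] sq_integrable_fun_of[of u] by metis

instantiation L2 :: real_inner
begin

lift_definition zero_L2 :: L2 is "\<lambda>x. 0"
  by (simp add: sq_integrable_zero)

lift_definition plus_L2 :: "L2 \<Rightarrow> L2 \<Rightarrow> L2" is "\<lambda>f g x. f x + g x"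
  by (auto simp: sq_integrable_add)

lift_definition uminus_L2 :: "L2 \<Rightarrow> L2" is "\<lambda>f x. - f x"
  by (auto simp: sq_integrable_uminus)

lift_definition minus_L2 :: "L2 \<Rightarrow> L2 \<Rightarrow> L2" is "\<lambda>f g x. f x - g x"
  by (auto simp: sq_integrable_diff)

lift_definition scaleR_L2 :: "real \<Rightarrow> L2 \<Rightarrow> L2" is "\<lambda>r f x. r *\<^sub>R f x"
  by (auto simp: sq_integrable_scaleR)

lift_definition inner_L2 :: "L2 \<Rightarrow> L2 \<Rightarrow> real" is
  "\<lambda>f g. Re (LINT x|I_pi. f x * cnj (g x))"
proof -
  fix f f' g g' assume *: "sq_integrable f \<and> sq_integrable f' \<and> (AE x in I_pi. f x = f' x)"
    "sq_integrable g \<and> sq_integrable g' \<and> (AE x in I_pi. g x = g' x)"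
  then have "AE x in I_pi. f x = f' x" "AE x in I_pi. g x = g' x" by auto
  then have "AE x in I_pi. f x * cnj (g x) = f' x * cnj (g' x)"
    by eventually_elim simp
  then have "(LINT x|I_pi. f x * cnj (g x)) = (LINT x|I_pi. f' x * cnj (g' x))"
    using * integrable_cnj_product[of f g] integrable_cnj_product[of f' g']
    by (intro integral_cong_AE) auto
  then show "Re (LINT x|I_pi. f x * cnj (g x)) = Re (LINT x|I_pi. f' x * cnj (g' x))" by simp
qed

definition norm_L2 :: "L2 \<Rightarrow> real" where "norm_L2 u = sqrt (u \<bullet> u)"
definition dist_L2 :: "L2 \<Rightarrow> L2 \<Rightarrow> real" where "dist_L2 u v = norm (u - v)"
definition sgn_L2 :: "L2 \<Rightarrow> L2" where "sgn_L2 u = scaleR (inverse (norm u)) u"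
definition uniformity_L2 :: "(L2 \<times> L2) filter" where
  "uniformity_L2 = (INF e\<in>{0 <..}. principal {(x, y). dist x y < e})"
definition open_L2 :: "L2 set \<Rightarrow> bool" where
  "open_L2 U \<longleftrightarrow> (\<forall>x\<in>U. eventually (\<lambda>(x', y). x' = x \<longrightarrow> y \<in> U) uniformity)"

instance
proof
  fix u v w :: L2 and r s :: real
  show "u + v + w = u + (v + w)" by transfer (auto simp: sq_integrable_add add.assoc)
  show "u + v = v + u" by transfer (auto simp: sq_integrable_add add.commute)
  show "0 + u = u" by transfer auto
  show "- u + u = 0" by transfer (auto simp: sq_integrable_zero)
  show "u - v = u + - v" by transfer (auto simp: sq_integrable_diff)
  show "r *\<^sub>R (u + v) = r *\<^sub>R u + r *\<^sub>R v"
    by transfer (auto simp: sq_integrable_add sq_integrable_scaleR scaleR_add_right)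
  show "(r + s) *\<^sub>R u = r *\<^sub>R u + s *\<^sub>R u"
    by transfer (auto simp: sq_integrable_add sq_integrable_scaleR scaleR_add_left)
  show "r *\<^sub>R s *\<^sub>R u = (r * s) *\<^sub>R u"
    by transfer (auto simp: sq_integrable_scaleR)
  show "1 *\<^sub>R u = u" by transfer auto
  show "dist u v = norm (u - v)" by (rule dist_L2_def)
  show "sgn u = scaleR (inverse (norm u)) u" by (rule sgn_L2_def)
  show "uniformity = (INF e\<in>{0 <..}. principal {(x, y). dist (x::L2) y < e})"
    by (rule uniformity_L2_def)
  show "open U \<longleftrightarrow> (\<forall>x\<in>U. eventually (\<lambda>(x', y). x' = x \<longrightarrow> y \<in> U) uniformity)" for U :: "L2 set"
    by (rule open_L2_def)
  show "norm u = sqrt (u \<bullet> u)" by (rule norm_L2_def)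
  show "u \<bullet> v = v \<bullet> u"
  proof transfer
    fix f g assume "sq_integrable f \<and> sq_integrable f \<and> (AE x in I_pi. f x = f x)"
       "sq_integrable g \<and> sq_integrable g \<and> (AE x in I_pi. g x = g x)"
    have "(LINT x|I_pi. f x * cnj (g x)) = (LINT x|I_pi. cnj (g x * cnj (f x)))"
      by (intro Bochner_Integration.integral_cong) auto
    also have "\<dots> = cnj (LINT x|I_pi. g x * cnj (f x))"
      by (rule Bochner_Integration.integral_cnj)
    finally show "Re (LINT x|I_pi. f x * cnj (g x)) = Re (LINT x|I_pi. g x * cnj (f x))"
      by simp
  qed
  show "(u + v) \<bullet> w = u \<bullet> w + v \<bullet> w"
    by transfer (simp add: ring_distribs integrable_cnj_product)
  show "(r *\<^sub>R u) \<bullet> v = r * (u \<bullet> v)"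
    by transfer (simp add: integrable_cnj_product)
  have *: "(LINT x|I_pi. f x * cnj (f x)) = of_real (LINT x|I_pi. (cmod (f x))\<^sup>2)" for f
    unfolding complex_norm_square[symmetric] by (rule integral_complex_of_real)
  show "0 \<le> u \<bullet> u"
    by transfer (simp add: * integral_nonneg_AE)
  show "(u \<bullet> u = 0) = (u = 0)"
  proof transfer
    fix f assume f: "sq_integrable f \<and> sq_integrable f \<and> (AE x in I_pi. f x = f x)"
    have "(LINT x|I_pi. (cmod (f x))\<^sup>2) = 0 \<longleftrightarrow> (AE x in I_pi. (cmod (f x))\<^sup>2 = 0)"
      using f by (intro integral_nonneg_eq_0_iff_AE) (auto simp: sq_integrable_def)
    then show "(Re (LINT x|I_pi. f x * cnj (f x)) = 0) =
         (sq_integrable f \<and> sq_integrable (\<lambda>x. 0) \<and> (AE x in I_pi. f x = 0))"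
      using f by (simp add: * sq_integrable_zero)
  qed
qed

end

lemma to_L2_arith:
  assumes "sq_integrable f" "sq_integrable g"
  shows "to_L2 f + to_L2 g = to_L2 (\<lambda>x. f x + g x)" "to_L2 f - to_L2 g = to_L2 (\<lambda>x. f x - g x)"
  using assms by (simp_all add: plus_L2.abs_eq minus_L2.abs_eq)

lemma scaleR_to_L2: "sq_integrable f \<Longrightarrow> r *\<^sub>R to_L2 f = to_L2 (\<lambda>x. r *\<^sub>R f x)"
  by (simp add: scaleR_L2.abs_eq)

lemma norm_to_L2:
  assumes "sq_integrable f"
  shows "norm (to_L2 f) = sqrt (LINT x|I_pi. (cmod (f x))\<^sup>2)"
  using assms unfolding norm_L2_def
  by (simp add: inner_L2.abs_eq complex_norm_square[symmetric] del: of_real_power)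


lemma norm_L2_power2_eq_nn:
  assumes "sq_integrable f"
  shows "ennreal ((norm (to_L2 f))\<^sup>2) = (\<integral>\<^sup>+x. ennreal ((cmod (f x))\<^sup>2) \<partial>I_pi)"
  using assms by (simp add: norm_to_L2 nn_integral_eq_integral sq_integrable_def)

instance L2 :: complete_space
proof
  fix X :: "nat \<Rightarrow> L2" assume C: "Cauchy X"
  have "\<forall>k. \<exists>N. \<forall>m\<ge>N. \<forall>n\<ge>N. norm (X m - X n) < (1/2)^k"
    using C unfolding Cauchy_def dist_norm by (metis half_gt_zero_iff zero_less_one zero_less_power)
  then obtain N where N: "\<And>k m n. m \<ge> N k \<Longrightarrow> n \<ge> N k \<Longrightarrow> norm (X m - X n) < (1/2)^k"
    by metis
  define r where "r = rec_nat (N 0) (\<lambda>k m. max (Suc m) (N (Suc k)))"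
  have r_Suc: "r (Suc k) = max (Suc (r k)) (N (Suc k))" for k by (simp add: r_def)
  have r_mono: "strict_mono r" by (auto simp: strict_mono_Suc_iff r_Suc)
  have r_ge: "r k \<ge> N k" for k by (cases k) (simp_all add: r_Suc, simp add: r_def)
  define G where "G k = fun_of (X (r k))" for k
  have G_sq: "sq_integrable (G k)" for k by (simp add: G_def sq_integrable_fun_of)
  have G_meas[measurable]: "G k \<in> borel_measurable I_pi" for k
    using G_sq by (simp add: sq_integrable_def)
  have X_eq: "X (r k) = to_L2 (G k)" for k by (simp add: G_def to_L2_fun_of)
  have XG: "X (r m) - X (r n) = to_L2 (\<lambda>x. G m x - G n x)" for m n
    by (simp add: X_eq to_L2_arith G_sq)
  have G_diff: "norm (to_L2 (\<lambda>x. G m x - G n x)) < (1/2)^k" if "m \<ge> k" "n \<ge> k" for k m n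
  proof -
    have "r m \<ge> N k" "r n \<ge> N k"
      using r_ge[of k] strict_mono_less_eq[OF r_mono] that by (meson order_trans)+
    then show ?thesis using N XG by metis
  qed
  have sq_diff: "sq_integrable (\<lambda>x. G m x - G n x)" for m n by (simp add: sq_integrable_diff G_sq)
  have fin: "(\<integral>\<^sup>+x. 1 \<partial>I_pi) = ennreal pi"
    by (simp add: emeasure_restrict_space)
  have int_le: "(\<integral>\<^sup>+x. ennreal (cmod (G (Suc k) x - G k x)) \<partial>I_pi) \<le> ennreal ((pi + 1) * (1/2)^k)" for k
  proof -
    let ?e = "(1/2)^k :: real" and ?h = "\<lambda>x. G (Suc k) x - G k x"
    have e: "?e > 0" by simp
    have "(\<integral>\<^sup>+x. ennreal (cmod (?h x)) \<partial>I_pi) \<le> (\<integral>\<^sup>+x. ennreal ?e * 1 + ennreal (1/?e) * ennreal ((cmod (?h x))\<^sup>2) \<partial>I_pi)"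
    proof (rule nn_integral_mono)
      fix x
      have "cmod (?h x) \<le> ?e + 1/?e * (cmod (?h x))\<^sup>2"
      proof (cases "cmod (?h x) \<le> ?e")
        case False
        then have "?e * cmod (?h x) \<le> cmod (?h x) * cmod (?h x)" by (intro mult_right_mono) auto
        then have "cmod (?h x) \<le> 1/?e * (cmod (?h x))\<^sup>2"
          using e by (simp add: field_simps power2_eq_square)
        then show ?thesis using e by linarith
      next
        case True
        moreover have "0 \<le> 1/?e * (cmod (?h x))\<^sup>2" by simp
        ultimately show ?thesis by linarith
      qed
      then show "ennreal (cmod (?h x)) \<le> ennreal ?e * 1 + ennreal (1/?e) * ennreal ((cmod (?h x))\<^sup>2)"
        using e by (simp add: ennreal_mult[symmetric] ennreal_plus[symmetric] del: ennreal_plus)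
    qed
    also have "\<dots> = ennreal ?e * ennreal pi + ennreal (1/?e) * ennreal ((norm (to_L2 ?h))\<^sup>2)"
      unfolding norm_L2_power2_eq_nn[OF sq_diff] fin[symmetric]
      by (subst nn_integral_add; (subst nn_integral_cmult)?; (subst nn_integral_cmult)?) (auto simp: nn_integral_cmult)
    also have "\<dots> = ennreal (?e * pi + 1/?e * (norm (to_L2 ?h))\<^sup>2)"
      using e by (simp add: ennreal_mult[symmetric] ennreal_plus[symmetric] del: ennreal_plus)
    also have "\<dots> \<le> ennreal ((pi + 1) * ?e)"
    proof (rule ennreal_leI)
      have "(norm (to_L2 ?h))\<^sup>2 \<le> ?e\<^sup>2"
        using G_diff[of k "Suc k" k] by (intro power_mono) auto
      then have "1/?e * (norm (to_L2 ?h))\<^sup>2 \<le> 1/?e * ?e\<^sup>2"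
        by (intro mult_left_mono) auto
      also have "\<dots> = ?e" by (simp add: power2_eq_square)
      finally show "?e * pi + 1/?e * (norm (to_L2 ?h))\<^sup>2 \<le> (pi + 1) * ?e"
        by (simp add: algebra_simps)
    qed
    finally show ?thesis .
  qed
  have "(\<integral>\<^sup>+x. (\<Sum>k. ennreal (cmod (G (Suc k) x - G k x))) \<partial>I_pi)
        = (\<Sum>k. \<integral>\<^sup>+x. ennreal (cmod (G (Suc k) x - G k x)) \<partial>I_pi)"
    by (rule nn_integral_suminf) measurable
  also have "\<dots> \<le> (\<Sum>k. ennreal ((pi + 1) * (1/2)^k))"
    by (intro suminf_le int_le) auto
  also have "\<dots> = ennreal (\<Sum>k. (pi + 1) * (1/2)^k)"
    by (intro suminf_ennreal2) (auto intro!: summable_mult summable_geometric add_nonneg_nonneg)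
  also have "\<dots> < \<infinity>" by simp
  finally have "(\<integral>\<^sup>+x. (\<Sum>k. ennreal (cmod (G (Suc k) x - G k x))) \<partial>I_pi) \<noteq> \<infinity>" by simp
  then have "AE x in I_pi. (\<Sum>k. ennreal (cmod (G (Suc k) x - G k x))) \<noteq> \<infinity>"
    by (intro nn_integral_PInf_AE) auto
  then have conv: "AE x in I_pi. convergent (\<lambda>k. G k x)"
  proof eventually_elim
    case (elim x)
    then have "summable (\<lambda>k. cmod (G (Suc k) x - G k x))"
      by (intro summable_suminf_not_top) auto
    then have "summable (\<lambda>k. G (Suc k) x - G k x)" by (rule summable_norm_cancel)
    then have "convergent (\<lambda>n. \<Sum>k<n. G (Suc k) x - G k x)" by (simp add: summable_iff_convergent)
    then have "convergent (\<lambda>n. G n x - G 0 x)" using sum_lessThan_telescope[of "\<lambda>k. G k x"] by simp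
    then show ?case using convergent_add[OF _ convergent_const[of "G 0 x"]] by fastforce
  qed
  define f where "f x = lim (\<lambda>k. G k x)" for x
  have f_meas[measurable]: "f \<in> borel_measurable I_pi"
    unfolding f_def by (rule borel_measurable_lim_metric) measurable
  have lim: "AE x in I_pi. (\<lambda>k. G k x) \<longlonglongrightarrow> f x"
    using conv unfolding f_def by eventually_elim (simp add: convergent_LIMSEQ_iff)
  have bound: "(\<integral>\<^sup>+x. ennreal ((cmod (f x - G k x))\<^sup>2) \<partial>I_pi) \<le> ennreal (((1/2)^k)\<^sup>2)" for k
  proof -
    have "AE x in I_pi. ennreal ((cmod (f x - G k x))\<^sup>2)
            = liminf (\<lambda>n. ennreal ((cmod (G n x - G k x))\<^sup>2))"
      using lim
    proof eventually_elim
      case (elim x)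
      then have "(\<lambda>n. ennreal ((cmod (G n x - G k x))\<^sup>2)) \<longlonglongrightarrow> ennreal ((cmod (f x - G k x))\<^sup>2)"
        by (intro tendsto_intros tendsto_ennrealI)
      then show ?case by (intro lim_imp_Liminf[symmetric]) simp_all
    qed
    then have "(\<integral>\<^sup>+x. ennreal ((cmod (f x - G k x))\<^sup>2) \<partial>I_pi)
          = (\<integral>\<^sup>+x. liminf (\<lambda>n. ennreal ((cmod (G n x - G k x))\<^sup>2)) \<partial>I_pi)"
      by (rule nn_integral_cong_AE)
    also have "\<dots> \<le> liminf (\<lambda>n. \<integral>\<^sup>+x. ennreal ((cmod (G n x - G k x))\<^sup>2) \<partial>I_pi)"
      by (rule nn_integral_liminf) measurable
    also have "\<dots> = liminf (\<lambda>n. ennreal ((norm (to_L2 (\<lambda>x. G n x - G k x)))\<^sup>2))"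
      by (simp add: norm_L2_power2_eq_nn sq_diff)
    also have "\<dots> \<le> limsup (\<lambda>n. ennreal ((norm (to_L2 (\<lambda>x. G n x - G k x)))\<^sup>2))"
      by (rule Liminf_le_Limsup) simp
    also have "\<dots> \<le> ennreal (((1/2)^k)\<^sup>2)"
    proof (rule Limsup_bounded)
      show "\<forall>\<^sub>F n in sequentially. ennreal ((norm (to_L2 (\<lambda>x. G n x - G k x)))\<^sup>2) \<le> ennreal (((1/2)^k)\<^sup>2)"
        using eventually_ge_at_top[of k]
      proof eventually_elim
        case (elim n)
        then have "norm (to_L2 (\<lambda>x. G n x - G k x)) \<le> (1/2)^k"
          using G_diff[of k n k] by simp
        then show ?case by (intro ennreal_leI power_mono) auto
      qed
    qed
    finally show ?thesis .
  qed
  have sq_f: "sq_integrable (\<lambda>x. f x - G k x)" for k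
    unfolding sq_integrable_def integrable_iff_bounded
    using le_less_trans[OF bound[of k] ennreal_less_top] by (simp add: top_unique)
  have sqf: "sq_integrable f"
    using sq_integrable_add[OF sq_f[of 0] G_sq[of 0]] by simp
  have "norm (to_L2 f - X (r k)) \<le> (1/2)^k" for k
  proof -
    have "ennreal ((norm (to_L2 f - X (r k)))\<^sup>2) \<le> ennreal (((1/2)^k)\<^sup>2)"
      using bound[of k] norm_L2_power2_eq_nn[OF sq_f[of k]]
      by (simp add: X_eq to_L2_arith sqf G_sq)
    then have "(norm (to_L2 f - X (r k)))\<^sup>2 \<le> ((1/2)^k)\<^sup>2" by (subst (asm) ennreal_le_iff) auto
    then show ?thesis by (rule power2_le_imp_le) simp
  qed
  then have "\<forall>\<^sub>F k in sequentially. norm (X (r k) - to_L2 f) \<le> (1/2)^k"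
    by (simp add: norm_minus_commute)
  moreover have "(\<lambda>k. (1/2)^k :: real) \<longlonglongrightarrow> 0" by (rule LIMSEQ_power_zero) simp
  ultimately have "(\<lambda>k. X (r k) - to_L2 f) \<longlonglongrightarrow> 0"
    using Lim_null_comparison[of "\<lambda>k. X (r k) - to_L2 f" "\<lambda>k. (1/2)^k" sequentially] by blast
  then have "(\<lambda>k. X (r k)) \<longlonglongrightarrow> to_L2 f" by (rule LIM_zero_cancel)
  then have "(X \<circ> r) \<longlonglongrightarrow> to_L2 f" by (simp add: o_def)
  then show "convergent X"
    using Cauchy_converges_subseq[OF C r_mono] convergentI by blast
qed

instance L2 :: banach ..

lemma to_L2_tendsto_dominated:
  assumes g: "\<And>n. g n \<in> borel_measurable I_pi" and w: "sq_integrable w" and f: "sq_integrable f"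
    and lim: "AE x in I_pi. (\<lambda>n. g n x) \<longlonglongrightarrow> f x"
    and le: "\<And>n. AE x in I_pi. cmod (g n x) \<le> cmod (w x)"
  shows "(\<lambda>n. to_L2 (g n)) \<longlonglongrightarrow> to_L2 f"
proof -
  have sg: "sq_integrable (g n)" for n
  proof (rule sq_integrable_bound[OF g sq_integrableD(2)[OF w]])
    show "AE x in I_pi. (cmod (g n x))\<^sup>2 \<le> (cmod (w x))\<^sup>2"
      using le[of n] by eventually_elim (intro power_mono, auto)
  qed
  have fm[measurable]: "f \<in> borel_measurable I_pi" and gm[measurable]: "\<And>n. g n \<in> borel_measurable I_pi"
    using f g by (auto simp: sq_integrable_def)
  have "(\<lambda>n. LINT x|I_pi. (cmod (g n x - f x))\<^sup>2) \<longlonglongrightarrow> (LINT x|I_pi. 0)"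
  proof (rule integral_dominated_convergence)
    show "integrable I_pi (\<lambda>x. 2 * (cmod (w x))\<^sup>2 + 2 * (cmod (f x))\<^sup>2)"
      using w f by (auto simp: sq_integrable_def)
    show "AE x in I_pi. (\<lambda>n. (cmod (g n x - f x))\<^sup>2) \<longlonglongrightarrow> 0"
      using lim
    proof eventually_elim
      case (elim x)
      then have "(\<lambda>n. (cmod (g n x - f x))\<^sup>2) \<longlonglongrightarrow> (cmod (f x - f x))\<^sup>2"
        by (intro tendsto_intros)
      then show ?case by simp
    qed
    show "AE x in I_pi. norm ((cmod (g n x - f x))\<^sup>2) \<le> 2 * (cmod (w x))\<^sup>2 + 2 * (cmod (f x))\<^sup>2" for n
      using le[of n]
    proof eventually_elim
      case (elim x)
      have "cmod (g n x - f x) \<le> cmod (w x) + cmod (f x)"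
        using norm_triangle_ineq4[of "g n x" "f x"] elim by linarith
      then have "(cmod (g n x - f x))\<^sup>2 \<le> (cmod (w x) + cmod (f x))\<^sup>2"
        by (intro power_mono) auto
      also have "\<dots> \<le> 2 * (cmod (w x))\<^sup>2 + 2 * (cmod (f x))\<^sup>2"
        using sum_squares_bound[of "cmod (w x)" "cmod (f x)"] by (simp add: power2_sum)
      finally show ?case by simp
    qed
  qed measurable
  then have "(\<lambda>n. sqrt (LINT x|I_pi. (cmod (g n x - f x))\<^sup>2)) \<longlonglongrightarrow> sqrt 0"
    by (intro tendsto_real_sqrt) simp
  moreover have "dist (to_L2 (g n)) (to_L2 f) = sqrt (LINT x|I_pi. (cmod (g n x - f x))\<^sup>2)" for n
    unfolding dist_norm to_L2_arith(2)[OF sg f] by (rule norm_to_L2[OF sq_integrable_diff[OF sg f]])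
  ultimately have "(\<lambda>n. dist (to_L2 (g n)) (to_L2 f)) \<longlonglongrightarrow> 0"
    unfolding real_sqrt_zero by presburger
  then show ?thesis by (rule iffD2[OF tendsto_dist_iff])
qed

lemma sq_integrable_const: "sq_integrable (\<lambda>x. c)"
proof -
  interpret finite_measure I_pi by (rule finite_measure_lebesgue_on) simp
  show ?thesis by (simp add: sq_integrable_def)
qed

lemma sq_integrable_indicator:
  "A \<in> sets lebesgue \<Longrightarrow> sq_integrable (\<lambda>x. c * indicator A x)"
  using sq_integrable_indicator_mult[OF sq_integrable_const[of c]] by (simp add: mult.commute)

instance L2 :: second_countable_topology
proof
  define e :: "rat \<times> rat \<times> rat \<Rightarrow> L2" where
    "e = (\<lambda>(p, q, a). to_L2 (\<lambda>x. Complex (of_rat p) (of_rat q) * indicator {..of_rat a} x))"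
  define D where "D = range (\<lambda>ps. sum_list (map e ps))"
  have D_add: "u + v \<in> D" if "u \<in> D" "v \<in> D" for u v
    using that unfolding D_def by (force simp flip: sum_list_append map_append)
  define V where "V = closure D"
  have D_V: "u \<in> V" if "u \<in> D" for u using that closure_subset unfolding V_def by blast
  have V_lim: "u \<in> V" if "\<And>n. x n \<in> V" "x \<longlonglongrightarrow> u" for x u
    using that closed_sequentially[of V x u] by (auto simp: V_def)
  have V_add: "u + v \<in> V" if "u \<in> V" "v \<in> V" for u v
  proof -
    obtain x where x: "\<And>n. x n \<in> D" "x \<longlonglongrightarrow> u"
      using \<open>u \<in> V\<close> unfolding V_def closure_sequential by blast
    obtain y where y: "\<And>n. y n \<in> D" "y \<longlonglongrightarrow> v"
      using \<open>v \<in> V\<close> unfolding V_def closure_sequential by blast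
    show ?thesis
      by (rule V_lim[OF D_V[OF D_add[OF x(1) y(1)]] tendsto_add[OF x(2) y(2)]])
  qed
  have V0: "0 \<in> V" by (rule D_V) (auto simp: D_def intro!: image_eqI[of _ _ "[]"])
  define I where "I c A = to_L2 (\<lambda>x. c * indicator A x)" for c and A :: "real set"
  have rat_seq: "\<exists>p :: nat \<Rightarrow> rat. (\<forall>n. a < of_rat (p n)) \<and> (\<lambda>n. of_rat (p n)) \<longlonglongrightarrow> a" for a :: real
  proof -
    have "\<forall>n. \<exists>p. a < of_rat p \<and> of_rat p < a + 1 / real (Suc n)"
      by (intro allI of_rat_dense) simp
    then obtain p where p: "\<And>n. a < of_rat (p n)" "\<And>n. of_rat (p n) < a + 1 / real (Suc n)"
      by metis
    have "(\<lambda>n. of_rat (p n)) \<longlonglongrightarrow> a"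
    proof (rule tendsto_sandwich[OF _ _ tendsto_const])
      show "(\<lambda>n. a + 1 / real (Suc n)) \<longlonglongrightarrow> a"
        using tendsto_add[OF tendsto_const[of a] LIMSEQ_inverse_real_of_nat] by (simp add: inverse_eq_divide)
      show "\<forall>\<^sub>F n in sequentially. a \<le> of_rat (p n)"
        using p(1) by (intro always_eventually allI less_imp_le)
      show "\<forall>\<^sub>F n in sequentially. of_rat (p n) \<le> a + 1 / real (Suc n)"
        using p(2) by (intro always_eventually allI less_imp_le)
    qed
    then show ?thesis using p by blast
  qed
  have V_half: "I c {..a} \<in> V" for c a
  proof -
    obtain p :: "nat \<Rightarrow> rat" where p: "(\<lambda>n. of_rat (p n)) \<longlonglongrightarrow> Re c"
      using rat_seq[of "Re c"] by blast
    obtain q :: "nat \<Rightarrow> rat" where q: "(\<lambda>n. of_rat (q n)) \<longlonglongrightarrow> Im c"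
      using rat_seq[of "Im c"] by blast
    obtain s :: "nat \<Rightarrow> rat" where s: "\<And>n. a < of_rat (s n)" "(\<lambda>n. of_rat (s n)) \<longlonglongrightarrow> a"
      using rat_seq[of a] by blast
    let ?g = "\<lambda>n x. Complex (of_rat (p n)) (of_rat (q n)) * indicator {..of_rat (s n)} x"
    have pq: "(\<lambda>n. Complex (of_rat (p n)) (of_rat (q n))) \<longlonglongrightarrow> c"
      using tendsto_Complex[OF p q] by (simp only: complex.collapse)
    obtain K where K: "\<And>n. cmod (Complex (of_rat (p n)) (of_rat (q n))) \<le> K" "K > 0"
      using convergent_imp_Bseq[OF convergentI[OF pq]] unfolding Bseq_def by blast
    have "(\<lambda>n. to_L2 (?g n)) \<longlonglongrightarrow> I c {..a}"
      unfolding I_def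
    proof (rule to_L2_tendsto_dominated)
      show "?g n \<in> borel_measurable I_pi" for n
        by (rule sq_integrableD(1)[OF sq_integrable_indicator]) auto
      show "sq_integrable (\<lambda>x. of_real K)" by (rule sq_integrable_const)
      show "sq_integrable (\<lambda>x. c * indicator {..a} x)" by (rule sq_integrable_indicator) auto
      show "AE x in I_pi. (\<lambda>n. ?g n x) \<longlonglongrightarrow> c * indicator {..a} x"
      proof (intro AE_I2 tendsto_mult pq)
        fix x
        have "\<forall>\<^sub>F n in sequentially. indicator {..of_rat (s n)} x = (indicator {..a} x :: complex)"
        proof (cases "x \<le> a")
          case True
          then have "x \<le> of_rat (s n)" for n using s(1)[of n] by linarith
          with True show ?thesis by (auto simp: indicator_def)
        next
          case False
          then have "\<forall>\<^sub>F n in sequentially. of_rat (s n) < x"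
            using order_tendstoD(2)[OF s(2)] by simp
          then show ?thesis by (rule eventually_mono) (use False in \<open>auto simp: indicator_def\<close>)
        qed
        then show "(\<lambda>n. indicator {..of_rat (s n)} x) \<longlonglongrightarrow> (indicator {..a} x :: complex)"
          by (rule tendsto_eventually)
      qed
      show "AE x in I_pi. cmod (?g n x) \<le> cmod (of_real K)" for n
        using K(1)[of n] K(2) by (intro AE_I2) (simp add: indicator_def)
    qed
    moreover have "to_L2 (?g n) \<in> V" for n
      by (rule D_V) (auto simp: D_def e_def intro!: image_eqI[of _ _ "[(p n, q n, s n)]"])
    ultimately show ?thesis using V_lim[of "\<lambda>n. to_L2 (?g n)"] by blast
  qed
  have I_AE: "I c A = I d B"
    if "A \<in> sets lebesgue" "B \<in> sets lebesgue"
      "AE x in I_pi. c * indicator A x = d * indicator B x" for c d A B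
    unfolding I_def using that by (subst to_L2_eq_iff) (auto intro: sq_integrable_indicator)
  have borel_leb: "A \<in> sets lebesgue" if "A \<in> sets borel" for A :: "real set"
    using that by auto
  have V_borel: "\<forall>c. I c A \<in> V" if "A \<in> sets borel" for A
  proof -
    have gen: "sets borel = sigma_sets UNIV (range (\<lambda>a::real. {..a}))"
      by (subst borel_eq_atMost) simp
    have "Int_stable (range (\<lambda>a::real. {..a}))" by (auto simp: Int_stable_def)
    moreover have "range (\<lambda>a::real. {..a}) \<subseteq> Pow UNIV" by simp
    moreover have "A \<in> sigma_sets UNIV (range (\<lambda>a::real. {..a}))" using that gen by simp
    ultimately show ?thesis
    proof (induction rule: sigma_sets_induct_disjoint)
      case (basic A)
      then show ?case using V_half by auto
    next
      case empty
      have "I c {} = 0" for c by (simp add: I_def zero_L2_def)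
      then show ?case using V0 by simp
    next
      case (compl A)
      then have A: "A \<in> sets lebesgue" using gen borel_leb by blast
      have "I c (UNIV - A) = I c {..pi} + I (- c) A" for c
      proof -
        have "I c {..pi} + I (- c) A = to_L2 (\<lambda>x. c * indicator {..pi} x + - c * indicator A x)"
          unfolding I_def by (intro to_L2_arith sq_integrable_indicator A) auto
        also have "\<dots> = I c (UNIV - A)"
          unfolding I_def
        proof (rule iffD2[OF to_L2_eq_iff])
          show "sq_integrable (\<lambda>x. c * indicator {..pi} x + - c * indicator A x)"
            by (intro sq_integrable_add sq_integrable_indicator A) auto
          show "sq_integrable (\<lambda>x. c * indicator (UNIV - A) x)"
            using A by (intro sq_integrable_indicator) auto
          show "AE x in I_pi. c * indicator {..pi} x + - c * indicator A x = c * indicator (UNIV - A) x"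
            by (rule AE_I2) (auto simp: indicator_def)
        qed
        finally show ?thesis ..
      qed
      then show ?case using compl V_half V_add by simp
    next
      case (union A)
      then have A: "A i \<in> sets lebesgue" for i using gen borel_leb by blast
      show ?case
      proof
        fix c
        have part: "I c (\<Union>i<n. A i) \<in> V" for n
        proof (induction n)
          case 0
          have "I c {} = 0" by (simp add: I_def zero_L2_def)
          then show ?case using V0 by simp
        next
          case (Suc n)
          have "I c (\<Union>i<n. A i) + I c (A n) = I c (\<Union>i<Suc n. A i)"
          proof -
            have "A n \<inter> A i = {}" if "i < n" for i
              using disjoint_family_onD[OF union(1), of n i] that by simp
            then have *: "(\<lambda>x. c * indicator (\<Union>i<n. A i) x + c * indicator (A n) x)
                = (\<lambda>x. c * indicator (\<Union>i<Suc n. A i) x)"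
              by (auto simp: indicator_def fun_eq_iff less_Suc_eq)
            show ?thesis unfolding I_def *[symmetric]
              by (intro to_L2_arith sq_integrable_indicator) (auto intro: A)
          qed
          moreover have "I c (A n) \<in> V" using union(3) by blast
          ultimately show ?case using V_add[OF Suc.IH, of "I c (A n)"] by simp
        qed
        have "(\<lambda>n. I c (\<Union>i<n. A i)) \<longlonglongrightarrow> I c (\<Union>i. A i)"
          unfolding I_def
        proof (rule to_L2_tendsto_dominated)
          show "(\<lambda>x. c * indicator (\<Union>i<n. A i) x) \<in> borel_measurable I_pi" for n
            by (rule sq_integrableD(1)[OF sq_integrable_indicator]) (auto intro: A)
          show "sq_integrable (\<lambda>x. c)" by (rule sq_integrable_const)
          show "sq_integrable (\<lambda>x. c * indicator (\<Union>i. A i) x)"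
            by (rule sq_integrable_indicator) (auto intro: A)
          show "AE x in I_pi. (\<lambda>n. c * indicator (\<Union>i<n. A i) x) \<longlonglongrightarrow> c * indicator (\<Union>i. A i) x"
            by (intro AE_I2 tendsto_mult tendsto_const LIMSEQ_indicator_UN)
        qed (auto simp: indicator_def)
        then show "I c (\<Union>i. A i) \<in> V" using part V_lim[of "\<lambda>n. I c (\<Union>i<n. A i)"] by blast
      qed
    qed
  qed
  have V_leb: "I c A \<in> V" if A: "A \<in> sets lebesgue" for c A
  proof -
    let ?B = "main_part lborel A"
    have B: "?B \<in> sets borel" using A main_part_sets[of A lborel] by simp
    obtain N where N: "N \<in> null_sets lborel" "null_part lborel A \<subseteq> N" using null_part[OF A] by blast
    have "AE x in lebesgue. x \<notin> N" using N(1) by (intro AE_not_in null_sets_completionI)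
    then have "AE x in I_pi. x \<notin> N"
      by (subst AE_restrict_space_iff) auto
    then have "AE x in I_pi. c * indicator A x = c * indicator ?B x"
    proof eventually_elim
      case (elim x)
      then show ?case using main_part_null_part_Un[OF A] N(2) by (auto simp: indicator_def)
    qed
    then have "I c A = I c ?B" using A B by (intro I_AE) auto
    then show ?thesis using V_borel[OF B] by simp
  qed
  have V_UNIV: "u \<in> V" for u
  proof -
    obtain f where u: "u = to_L2 f" and f: "sq_integrable f" by (rule L2_cases)
    obtain s where s: "\<And>i. simple_function I_pi (s i)"
        "\<And>x. x \<in> space I_pi \<Longrightarrow> (\<lambda>i. s i x) \<longlonglongrightarrow> f x"
        "\<And>i x. x \<in> space I_pi \<Longrightarrow> dist (s i x) 0 \<le> 2 * dist (f x) 0"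
      using borel_measurable_implies_sequence_metric[OF sq_integrableD(1)[OF f], of 0] by metis
    have "to_L2 (s i) \<in> V" for i
    proof -
      let ?S = "\<lambda>y. s i -` {y} \<inter> space I_pi"
      have S: "?S y \<in> sets lebesgue" for y
        using simple_functionD(2)[OF s(1), of i "{y}"]
        by (auto simp: sets_restrict_space_iff)
      have fin: "finite (s i ` space I_pi)" by (rule simple_functionD(1)[OF s(1)])
      have sum: "sq_integrable (\<lambda>x. \<Sum>y\<in>Y. y * indicator (?S y) x) \<and>
          to_L2 (\<lambda>x. \<Sum>y\<in>Y. y * indicator (?S y) x) \<in> V" if "finite Y" for Y
        using that
      proof induction
        case empty
        then show ?case using V0 sq_integrable_zero by (simp add: zero_L2_def)
      next
        case (insert y Y)
        let ?h = "\<lambda>x. y * indicator (?S y) x" and ?g = "\<lambda>x. \<Sum>y\<in>Y. y * indicator (?S y) x"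
        have h: "sq_integrable ?h" by (rule sq_integrable_indicator[OF S])
        have g: "sq_integrable ?g" "to_L2 ?g \<in> V" using insert.IH by blast+
        have "sq_integrable (\<lambda>x. ?h x + ?g x)" by (rule sq_integrable_add[OF h g(1)])
        moreover have "to_L2 (\<lambda>x. ?h x + ?g x) \<in> V"
          using V_add[OF V_leb[OF S, of y y] g(2)] unfolding I_def to_L2_arith(1)[OF h g(1)] .
        ultimately show ?case unfolding sum.insert[OF insert.hyps] by blast
      qed
      have "s i \<in> borel_measurable I_pi" using s(1) by (rule borel_measurable_simple_function)
      then have "sq_integrable (s i)"
      proof (rule sq_integrable_bound)
        show "integrable I_pi (\<lambda>x. 4 * (cmod (f x))\<^sup>2)" using f by (auto simp: sq_integrable_def)
        show "AE x in I_pi. (cmod (s i x))\<^sup>2 \<le> 4 * (cmod (f x))\<^sup>2"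
        proof (rule AE_I2)
          fix x assume "x \<in> space I_pi"
          then have "(cmod (s i x))\<^sup>2 \<le> (2 * cmod (f x))\<^sup>2"
            using s(3)[of x i] by (intro power_mono) auto
          then show "(cmod (s i x))\<^sup>2 \<le> 4 * (cmod (f x))\<^sup>2" by (simp add: power_mult_distrib)
        qed
      qed
      moreover have "AE x in I_pi. s i x = (\<Sum>y\<in>s i ` space I_pi. y * indicator (?S y) x)"
      proof (rule AE_I2)
        fix x assume "x \<in> space I_pi"
        from simple_function_indicator_representation_banach[OF s(1) this, of i]
        have "s i x = (\<Sum>y\<in>s i ` space I_pi. indicator (?S y) x *\<^sub>R y)" .
        also have "\<dots> = (\<Sum>y\<in>s i ` space I_pi. y * indicator (?S y) x)"
          by (intro sum.cong refl) (auto simp: indicator_def)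
        finally show "s i x = (\<Sum>y\<in>s i ` space I_pi. y * indicator (?S y) x)" .
      qed
      ultimately have "to_L2 (s i) = to_L2 (\<lambda>x. \<Sum>y\<in>s i ` space I_pi. y * indicator (?S y) x)"
        using sum[OF fin] by (subst to_L2_eq_iff) auto
      then show ?thesis using sum[OF fin] by simp
    qed
    moreover have "(\<lambda>i. to_L2 (s i)) \<longlonglongrightarrow> u"
      unfolding u
    proof (rule to_L2_tendsto_dominated)
      show "s i \<in> borel_measurable I_pi" for i using s(1) by (rule borel_measurable_simple_function)
      show "sq_integrable (\<lambda>x. 2 * f x)" by (rule sq_integrable_mult[OF f])
      show "AE x in I_pi. cmod (s i x) \<le> cmod (2 * f x)" for i
        using s(3) by (intro AE_I2) (auto simp: norm_mult)
    qed (use f s in auto)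
    ultimately show ?thesis using V_lim[of "\<lambda>i. to_L2 (s i)"] by blast
  qed
  have dense: "\<exists>d\<in>D. dist d u < \<epsilon>" if "\<epsilon> > 0" for u \<epsilon>
    using V_UNIV[of u] that unfolding V_def closure_approachable by blast
  let ?B = "(\<lambda>(d, n::nat). ball d (1 / real (Suc n))) ` (D \<times> UNIV)"
  have "countable ?B" by (auto simp: D_def intro!: countable_image countable_SIGMA)
  moreover have "topological_basis ?B"
  proof (rule topological_basisI)
    fix U and u :: L2 assume "open U" "u \<in> U"
    then obtain \<epsilon> where \<epsilon>: "\<epsilon> > 0" "ball u \<epsilon> \<subseteq> U" using open_contains_ball by blast
    obtain n where n: "1 / real (Suc n) < \<epsilon> / 2" using nat_approx_posE[of "\<epsilon> / 2"] \<epsilon>(1) by auto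
    obtain d where d: "d \<in> D" "dist d u < 1 / real (Suc n)" using dense[of "1 / real (Suc n)" u] by auto
    have "ball d (1 / real (Suc n)) \<subseteq> U"
    proof (rule subset_trans[OF _ \<epsilon>(2)], rule subsetI)
      fix v assume "v \<in> ball d (1 / real (Suc n))"
      then show "v \<in> ball u \<epsilon>"
        using n d(2) dist_triangle3[of u v d] by (simp add: dist_commute)
    qed
    then show "\<exists>B'\<in>?B. u \<in> B' \<and> B' \<subseteq> U"
      using d by (intro bexI[of _ "ball d (1 / real (Suc n))"]) auto
  qed auto
  ultimately show "\<exists>B::L2 set set. countable B \<and> open = generate_topology B"
    using topological_basis_imp_subbasis by blast
qed

definition L2_mean_zero :: "L2 set" where
  "L2_mean_zero = {u. (LINT x|I_pi. fun_of u x) = 0}"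

text \<open>Multiplication by the characteristic function of \<open>A\<close> (used for measurable \<open>A\<close> only).\<close>

definition cutoff :: "real set \<Rightarrow> L2 \<Rightarrow> L2" where
  "cutoff A u = to_L2 (\<lambda>x. indicator A x * fun_of u x)"


section \<open>Sobolev spaces on \<open>(0,\<pi>)\<close>\<close>

definition vderiv :: "(real \<Rightarrow> complex) \<Rightarrow> real \<Rightarrow> complex" where
  "vderiv \<phi> x = vector_derivative \<phi> (at x)"

text \<open>\<open>C\<^sub>c\<^sup>\<infinity>(0,\<pi>)\<close>, the functions being extended by zero to the real line.\<close>

definition test_function :: "(real \<Rightarrow> complex) \<Rightarrow> bool" where
  "test_function \<phi> \<longleftrightarrow>
     (\<forall>k x. (vderiv ^^ k) \<phi> differentiable (at x)) \<and> closure {x. \<phi> x \<noteq> 0} \<subseteq> {0<..<pi}"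

definition has_weak_derivative :: "L2 \<Rightarrow> L2 \<Rightarrow> bool" where
  "has_weak_derivative u v \<longleftrightarrow>
     (\<forall>\<phi>. test_function \<phi> \<longrightarrow>
        (LINT x|I_pi. fun_of u x * vderiv \<phi> x) = - (LINT x|I_pi. fun_of v x * \<phi> x))"

text \<open>
  \<open>H\<^sub>0\<^sup>1(0,\<pi>)\<close> is the closure of the test functions in \<open>H\<^sup>1(0,\<pi>)\<close>.  The norm of the pair \<open>(u, u')\<close> in
  \<open>L2 \<times> L2\<close> is the \<open>H\<^sup>1\<close> norm of \<open>u\<close>, so the closure is taken among such pairs.
\<close>

definition H1_0 :: "L2 set" where
  "H1_0 = {u. \<exists>v. has_weak_derivative u v \<and>
                 (u, v) \<in> closure {(to_L2 \<phi>, to_L2 (vderiv \<phi>)) | \<phi>. test_function \<phi>}}"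


section \<open>Strongly continuous semigroups and mild solutions\<close>

definition C0_semigroup :: "(real \<Rightarrow> 'a::real_normed_vector \<Rightarrow> 'a) \<Rightarrow> bool" where
  "C0_semigroup S \<longleftrightarrow>
     (\<forall>t\<ge>0. bounded_linear (S t)) \<and>
     S 0 = id \<and>
     (\<forall>s\<ge>0. \<forall>t\<ge>0. S (s + t) = S s \<circ> S t) \<and>
     (\<forall>z. ((\<lambda>t. S t z) \<longlongrightarrow> z) (at_right 0))"

text \<open>Unbounded operators are represented by their graphs.\<close>

definition generator :: "(real \<Rightarrow> 'a::real_normed_vector \<Rightarrow> 'a) \<Rightarrow> ('a \<times> 'a) set" where
  "generator S = {(z, w). ((\<lambda>h. (S h z - z) /\<^sub>R h) \<longlongrightarrow> w) (at_right 0)}"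

text \<open>
  The mild solution of \<open>z' = \<A> z + F\<close>, \<open>z(0) = z0\<close>, where \<open>S\<close> is the semigroup generated by \<open>\<A>\<close>.
\<close>

definition mild_solution ::
    "(real \<Rightarrow> 'a \<Rightarrow> 'a) \<Rightarrow> (real \<Rightarrow> 'a) \<Rightarrow> 'a \<Rightarrow> real \<Rightarrow> 'a::{banach, second_countable_topology}" where
  "mild_solution S F z0 t = S t z0 + (LINT s|lebesgue_on {0..t}. S (t - s) (F s))"


section \<open>The linearised Navier-Stokes system with Maxwell's law\<close>

type_synonym state = "L2 \<times> L2 \<times> L2"

text \<open>
  In the second component \<open>-b \<rho>' + S'/\<rho>\<^sub>s\<close> is the weak derivative of \<open>-b \<rho> + S/\<rho>\<^sub>s\<close>; on the domain
  neither \<open>\<rho>\<close> nor \<open>S\<close> need be weakly differentiable.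
\<close>

definition system_operator ::
    "real \<Rightarrow> real \<Rightarrow> real \<Rightarrow> real \<Rightarrow> real \<Rightarrow> (state \<times> state) set" where
  "system_operator a \<gamma> \<rho>s \<mu> \<kappa> =
     (let b = a * \<gamma> * \<rho>s powr (\<gamma> - 2) in
      {((\<rho>, u, S), (- (\<rho>s *\<^sub>R u'), q', (\<mu> / \<kappa>) *\<^sub>R u' - (1 / \<kappa>) *\<^sub>R S)) | \<rho> u S u' q'.
         u \<in> H1_0 \<and> has_weak_derivative u u' \<and>
         has_weak_derivative (- (b *\<^sub>R \<rho>) + (1 / \<rho>s) *\<^sub>R S) q'})"

text \<open>\<open>L\<^sup>2(0,T; L\<^sup>2(A))\<close>, where \<open>L\<^sup>2(A)\<close> is the space of functions in \<open>L\<^sup>2(0,\<pi>)\<close> that vanish outside \<open>A\<close>.\<close>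

definition controls :: "real \<Rightarrow> real set \<Rightarrow> (real \<Rightarrow> L2) set" where
  "controls T A = {f. f \<in> borel_measurable (lebesgue_on {0..T}) \<and>
                      integrable (lebesgue_on {0..T}) (\<lambda>t. (norm (f t))\<^sup>2) \<and>
                      (AE t in lebesgue_on {0..T}. cutoff A (f t) = f t)}"

definition null_controllable ::
    "(real \<Rightarrow> state \<Rightarrow> state) \<Rightarrow> real set \<Rightarrow> state set \<Rightarrow> real \<Rightarrow> bool" where
  "null_controllable S A X T \<longleftrightarrow>
     (\<forall>z0\<in>X. \<exists>f\<in>controls T A. mild_solution S (\<lambda>t. (0, cutoff A (f t), 0)) z0 T = 0)"

end

theory Submission
  imports Defs "HOL-Computational_Algebra.Polynomial" "HOL-Real_Asymp.Real_Asymp"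
begin

text \<open>
  For every \<open>n \<ge> 1\<close> the adjoint of the system operator has an eigenvector
  \<open>(cos (n x), \<nu> / (b n) sin (n x), r cos (n x))\<close> with a real eigenvalue \<open>\<nu> \<in> [-1/\<kappa>, 0]\<close>. These
  eigenvalues stay bounded as \<open>n\<close> grows, so the velocity component, the only one seen by the control,
  is \<open>O(1/n)\<close>. Testing a controlled solution that vanishes at time \<open>T\<close> and starts from \<open>(\<rho>, 0, 0)\<close>
  against this eigenvector gives \<open>\<langle>\<rho>, cos (n x)\<rangle> = O(1/n)\<close>, whatever the control region is. The
  lacunary series \<open>\<rho> = \<Sum>k. 2\<^sup>-\<^sup>k cos (4\<^sup>k x)\<close> violates this bound.
\<close>

section \<open>Eigenfunctionals of strongly continuous semigroups\<close>

text \<open>Baire category: the closed sets \<open>A m\<close> cover the space by the pointwise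
  bounds, so one of them contains a ball, and linearity carries the bound on that ball to all
  vectors.\<close>

lemma uniform_boundedness:
  fixes f :: "nat \<Rightarrow> 'a::banach \<Rightarrow> 'b::real_normed_vector"
  assumes lin: "\<And>n. bounded_linear (f n)" and bd: "\<And>x. \<exists>M. \<forall>n. norm (f n x) \<le> M"
  shows "\<exists>M. \<forall>n x. norm (f n x) \<le> M * norm x"
proof -
  define A where "A m = {x. \<forall>n. norm (f n x) \<le> real m}" for m
  have closed: "closed (A m)" for m
    unfolding A_def Collect_all_eq
    by (intro closed_INT ballI closed_Collect_le continuous_intros
        linear_continuous_on lin)
  have "(\<Union>m. A m) = UNIV"
  proof -
    have "\<exists>m. x \<in> A m" for x
    proof -
      obtain M where "\<forall>n. norm (f n x) \<le> M" using bd by blast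
      then show ?thesis
        using real_arch_simple[of M] order_trans unfolding A_def by blast
    qed
    then show ?thesis by blast
  qed
  then obtain m where "interior (A m) \<noteq> {}"
    using Baire_category_alt[of "euclidean :: 'a topology" "range A"] closed
    by (fastforce simp: completely_metrizable_space_euclidean)
  then obtain x e where e: "e > 0" "cball x e \<subseteq> A m"
    by (meson ex_in_conv mem_interior_cball)
  have "norm (f n y) \<le> (2 * real m / e) * norm y" for n y
  proof (cases "y = 0")
    case True
    then show ?thesis by (simp add: linear_0[OF bounded_linear.linear[OF lin]])
  next
    case False
    \<comment> \<open>\<open>v\<close> has norm \<open>e\<close>, so \<open>x\<close> and
      \<open>x + v\<close> both lie in the ball and \<open>f n v\<close> is a difference of two
      values of norm at most \<open>m\<close>. Scaling back by \<open>e / norm y\<close> gives the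
      factor \<open>2 * m / e\<close>.\<close>
    define v where "v = (e / norm y) *\<^sub>R y"
    have "x + v \<in> A m" "x \<in> A m"
      using e False by (auto simp: v_def dist_norm intro!: subsetD[OF e(2)])
    then have "norm (f n (x + v)) \<le> m" "norm (f n x) \<le> m" by (auto simp: A_def)
    moreover have "f n v = f n (x + v) - f n x"
      by (simp add: linear_add[OF bounded_linear.linear[OF lin]])
    ultimately have "norm (f n v) \<le> 2 * real m"
      using norm_triangle_ineq4[of "f n (x + v)" "f n x"] by simp
    moreover have "norm (f n v) = (e / norm y) * norm (f n y)"
      using e by (simp add: v_def linear_scale[OF bounded_linear.linear[OF lin]])
    ultimately show ?thesis using e False by (simp add: field_simps)
  qed
  then show ?thesis by blast
qed

section \<open>Operator bounds and continuity of orbits\<close>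

lemma C0_semigroupD:
  assumes "C0_semigroup S"
  shows "t \<ge> 0 \<Longrightarrow> bounded_linear (S t)" "S 0 z = z"
    "s \<ge> 0 \<Longrightarrow> t \<ge> 0 \<Longrightarrow> S (s + t) z = S s (S t z)"
    "((\<lambda>t. S t z) \<longlongrightarrow> z) (at_right 0)"
  using assms by (simp_all add: C0_semigroup_def)

text \<open>Otherwise there are times \<open>t n\<close> tending to 0 at which the operator norm of
  \<open>S (t n)\<close> exceeds \<open>n\<close>. Strong continuity at 0 bounds each sequence
  \<open>S (t n) z\<close>, so uniform boundedness gives a contradiction.\<close>

lemma C0_semigroup_bounded_near_0:
  fixes S :: "real \<Rightarrow> 'a::banach \<Rightarrow> 'a"
  assumes S: "C0_semigroup S"
  shows "\<exists>M \<delta>. \<delta> > 0 \<and> (\<forall>t\<in>{0..\<delta>}. \<forall>z. norm (S t z) \<le> M * norm z)"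
proof (rule ccontr)
  assume "\<not> ?thesis"
  then have "\<exists>t\<in>{0..1 / Suc n}. \<exists>z. norm (S t z) > real n * norm z" for n
    by (metis of_nat_0_less_iff zero_less_Suc zero_less_divide_1_iff not_le)
  then obtain t where t: "\<And>n. t n \<in> {0..1 / Suc n}" "\<And>n. \<exists>z. norm (S (t n) z) > real n * norm z"
    by metis
  have t0: "t \<longlonglongrightarrow> 0"
    using t(1) by (intro tendsto_sandwich[OF _ _ tendsto_const LIMSEQ_inverse_real_of_nat])
      (auto simp: inverse_eq_divide)
  have "\<exists>M. \<forall>n. norm (S (t n) z) \<le> M" for z
  proof -
    \<comment> \<open>Some \<open>t n\<close> may equal 0, which the limit along
      \<open>at_right 0\<close> does not cover; \<open>S 0 z = z\<close> turns it into continuity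
      within \<open>{0..}\<close>.\<close>
    have "continuous (at 0 within {0..}) (\<lambda>t. S t z)"
      using C0_semigroupD(4)[OF S, of z] C0_semigroupD(2)[OF S, of z]
      by (simp add: continuous_within at_within_Ici_at_right)
    then have "(\<lambda>n. S (t n) z) \<longlonglongrightarrow> z"
      using t0 t(1) C0_semigroupD(2)[OF S, of z]
      by (auto simp: continuous_within_sequentially o_def)
    then have "Bseq (\<lambda>n. S (t n) z)" by (intro convergent_imp_Bseq convergentI)
    then show ?thesis unfolding Bseq_def by blast
  qed
  moreover have "bounded_linear (S (t n))" for n
    using t(1)[of n] by (intro C0_semigroupD[OF S]) auto
  ultimately obtain M where M: "\<And>n z. norm (S (t n) z) \<le> M * norm z"
    using uniform_boundedness[of "\<lambda>n. S (t n)"] by blast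
  obtain n where n: "M \<le> real n" using real_arch_simple by blast
  obtain z where "norm (S (t n) z) > real n * norm z" using t(2) by blast
  then show False using M[of n z] mult_right_mono[OF n norm_ge_zero[of z]] by linarith
qed

text \<open>Right continuity follows from the semigroup law and the limit at 0. From the left, the
  difference is \<open>S s (z - S (t - s) z)\<close>, which needs a bound on \<open>S s\<close>
  uniform for \<open>s\<close> near \<open>t\<close>.\<close>

lemma C0_semigroup_continuous:
  fixes S :: "real \<Rightarrow> 'a::banach \<Rightarrow> 'a"
  assumes S: "C0_semigroup S"
  shows "continuous_on {0..} (\<lambda>t. S t z)"
  unfolding continuous_on_def
proof
  fix t :: real assume "t \<in> {0..}"
  then have t: "t \<ge> 0" by simp
  have right: "((\<lambda>s. S s z) \<longlongrightarrow> S t z) (at_right t)"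
  proof -
    have "((\<lambda>h. S h (S t z)) \<longlongrightarrow> S t z) (at_right 0)"
      by (rule C0_semigroupD(4)[OF S])
    moreover have "\<forall>\<^sub>F h in at_right 0. S h (S t z) = S (h + t) z"
      using eventually_at_right_less[of 0] by eventually_elim (use t in \<open>simp add: C0_semigroupD(3)[OF S]\<close>)
    ultimately have "((\<lambda>h. S (h + t) z) \<longlongrightarrow> S t z) (at_right 0)"
      by (rule Lim_transform_eventually)
    then show ?thesis by (subst filterlim_at_right_to_0)
  qed
  show "((\<lambda>s. S s z) \<longlongrightarrow> S t z) (at t within {0..})"
  proof (cases "t = 0")
    case True
    then show ?thesis using right by (simp add: at_within_Ici_at_right)
  next
    case False
    obtain M \<delta> where \<delta>: "\<delta> > 0" and M: "\<And>t z. t \<in> {0..\<delta>} \<Longrightarrow> norm (S t z) \<le> M * norm z"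
      using C0_semigroup_bounded_near_0[OF S] by blast
    \<comment> \<open>\<open>c\<close> lies at most \<delta> to the left of \<open>t\<close>. For
      \<open>s\<close> between \<open>c\<close> and \<open>t\<close>, \<open>S s\<close> factors
      into the fixed operator \<open>S c\<close>, bounded by \<open>K\<close>, and
      \<open>S (s - c)\<close>, bounded by \<open>M\<close>.\<close>
    define c where "c = t - min \<delta> t"
    have c: "0 \<le> c" "c < t" "t - c \<le> \<delta>" using False t \<delta> by (auto simp: c_def)
    obtain K where K: "K \<ge> 0" "\<And>y. norm (S c y) \<le> norm y * K"
      using bounded_linear.nonneg_bounded[OF C0_semigroupD(1)[OF S c(1)]] by blast
    have "((\<lambda>s. S s z - S t z) \<longlongrightarrow> 0) (at_left t)"
    proof (rule Lim_null_comparison)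
      show "\<forall>\<^sub>F s in at_left t. norm (S s z - S t z) \<le> M * norm (z - S (t - s) z) * K"
        using eventually_at_left_real[OF c(2)]
      proof eventually_elim
        case (elim s)
        have lin: "linear (S r)" if "r \<ge> 0" for r
          using C0_semigroupD(1)[OF S that] by (rule bounded_linear.linear)
        have "S t z = S s (S (t - s) z)"
          using C0_semigroupD(3)[OF S, of s "t - s" z] elim c by simp
        then have "S s z - S t z = S s (z - S (t - s) z)"
          using elim c by (simp add: linear_diff[OF lin])
        also have "\<dots> = S c (S (s - c) (z - S (t - s) z))"
          using C0_semigroupD(3)[OF S, of c "s - c"] elim c by simp
        also have "norm \<dots> \<le> norm (S (s - c) (z - S (t - s) z)) * K" by (rule K)
        also have "\<dots> \<le> M * norm (z - S (t - s) z) * K"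
          using elim c K by (intro mult_right_mono M) auto
        finally show ?case .
      qed
      have "filterlim (\<lambda>s. t - s) (at_right 0) (at_left t)"
        by (intro filterlim_at_withinI) (auto intro!: tendsto_eq_intros simp: eventually_at_filter)
      then have "((\<lambda>s. S (t - s) z) \<longlongrightarrow> z) (at_left t)"
        by (rule filterlim_compose[OF C0_semigroupD(4)[OF S]])
      then show "((\<lambda>s. M * norm (z - S (t - s) z) * K) \<longlongrightarrow> 0) (at_left t)"
        by (auto intro!: tendsto_eq_intros)
    qed
    then have "((\<lambda>s. S s z) \<longlongrightarrow> S t z) (at t)"
      using right by (intro filterlim_split_at) (auto intro: LIM_zero_cancel)
    then show ?thesis by (rule tendsto_within_subset) simp
  qed
qed

section \<open>Integrated orbits and functionals that are eigenvectors of the adjoint\<close>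

lemma integral_right_derivative:
  fixes c :: "real \<Rightarrow> 'a::banach"
  assumes c: "continuous_on {0..} c" and t: "t \<ge> 0"
  shows "((\<lambda>h. (integral {0..t + h} c - integral {0..t} c) /\<^sub>R h) \<longlongrightarrow> c t) (at_right 0)"
proof -
  have "((\<lambda>u. integral {0..u} c) has_vector_derivative c t) (at t within {0..t + 1})"
    using t by (intro integral_has_vector_derivative continuous_on_subset[OF c]) auto
  then have "((\<lambda>u. integral {0..u} c) has_vector_derivative c t) (at t within {t<..<t + 1})"
    by (rule has_vector_derivative_within_subset) (use t in auto)
  moreover have "at t within {t<..<t + 1} = at_right t"
    by (rule at_within_nhd[of _ "{..<t + 1}"]) auto
  ultimately have "((\<lambda>u. (integral {0..u} c - integral {0..t} c - (u - t) *\<^sub>R c t) /\<^sub>R norm (u - t))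
      \<longlongrightarrow> 0) (at_right t)"
    by (simp add: has_vector_derivative_def has_derivative_at_within)
  moreover have "\<forall>\<^sub>F u in at_right t. (integral {0..u} c - integral {0..t} c - (u - t) *\<^sub>R c t) /\<^sub>R norm (u - t)
      = (integral {0..u} c - integral {0..t} c) /\<^sub>R (u - t) - c t"
    using eventually_at_right_less[of t] by eventually_elim (simp add: scaleR_diff_right)
  ultimately have "((\<lambda>u. (integral {0..u} c - integral {0..t} c) /\<^sub>R (u - t) - c t) \<longlongrightarrow> 0) (at_right t)"
    by (rule Lim_transform_eventually)
  then have "((\<lambda>u. (integral {0..u} c - integral {0..t} c) /\<^sub>R (u - t)) \<longlongrightarrow> c t) (at_right t)"
    by (rule LIM_zero_cancel)
  then show ?thesis by (subst (asm) filterlim_at_right_to_0) (simp add: add.commute)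
qed

text \<open>An integrated orbit lies in the domain for every \<open>z\<close>, smooth or not.
  Applying \<open>S h\<close> shifts the interval of integration to \<open>{h..t + h}\<close>, so
  the generator quotient is the difference of the quotients at the two end points, which tend to
  \<open>c t\<close> and \<open>c 0\<close>.\<close>

lemma generator_integral:
  fixes S :: "real \<Rightarrow> 'a::banach \<Rightarrow> 'a"
  assumes S: "C0_semigroup S" and t: "t \<ge> 0"
  shows "(integral {0..t} (\<lambda>s. S s z), S t z - z) \<in> generator S"
proof -
  define c where "c = (\<lambda>s. S s z)"
  have c: "continuous_on {0..} c" unfolding c_def by (rule C0_semigroup_continuous[OF S])
  have int: "c integrable_on {a..b}" if "a \<ge> 0" for a b
    using that by (intro integrable_continuous_real continuous_on_subset[OF c]) auto
  have "((\<lambda>h. (integral {0..t + h} c - integral {0..t} c) /\<^sub>R h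
           - (integral {0..0 + h} c - integral {0..0} c) /\<^sub>R h) \<longlongrightarrow> c t - c 0) (at_right 0)"
    by (intro tendsto_diff integral_right_derivative c t) auto
  moreover have "\<forall>\<^sub>F h in at_right 0. (integral {0..t + h} c - integral {0..t} c) /\<^sub>R h
           - (integral {0..0 + h} c - integral {0..0} c) /\<^sub>R h
         = (S h (integral {0..t} c) - integral {0..t} c) /\<^sub>R h"
    using eventually_at_right_less[of 0]
  proof eventually_elim
    case (elim h)
    have "S h (integral {0..t} c) = integral {0..t} (S h \<circ> c)"
      using elim int by (intro integral_linear[symmetric] C0_semigroupD(1)[OF S]) auto
    also have "\<dots> = integral {0..t} (c \<circ> (+) h)"
      using elim C0_semigroupD(3)[OF S]
      by (intro Henstock_Kurzweil_Integration.integral_cong) (auto simp: c_def)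
    also have "\<dots> = integral {h..t + h} c" by (simp add: integral_shift_Icc_real)
    finally have "integral {0..h} c + S h (integral {0..t} c) = integral {0..t + h} c"
      using elim t int Henstock_Kurzweil_Integration.integral_combine[of 0 h "t + h" c] by simp
    then have "S h (integral {0..t} c) = integral {0..t + h} c - integral {0..h} c"
      by (simp add: algebra_simps)
    then show ?case by (simp add: scaleR_diff_right)
  qed
  ultimately have "((\<lambda>h. (S h (integral {0..t} c) - integral {0..t} c) /\<^sub>R h) \<longlongrightarrow> c t - c 0) (at_right 0)"
    by (rule Lim_transform_eventually)
  then show ?thesis
    by (simp add: generator_def c_def C0_semigroupD(2)[OF S])
qed

text \<open>This replaces the adjoint semigroup: the eigenvalue relation is assumed only on the
  graph of the generator. On integrated orbits it becomes the integral equation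
  \<open>l (S s z) = l z + \<mu> * J s\<close>, a scalar linear differential equation for
  \<open>J\<close>.\<close>

lemma C0_semigroup_eigenfunctional:
  fixes S :: "real \<Rightarrow> 'a::banach \<Rightarrow> 'a" and l :: "'a \<Rightarrow> real"
  assumes S: "C0_semigroup S" and l: "bounded_linear l"
    and eig: "\<And>z w. (z, w) \<in> generator S \<Longrightarrow> l w = \<mu> * l z"
    and t: "t \<ge> 0"
  shows "l (S t z) = exp (\<mu> * t) * l z"
proof -
  define J where "J s = l (integral {0..s} (\<lambda>r. S r z))" for s
  have G: "l (S s z) = l z + \<mu> * J s" if "s \<ge> 0" for s
    using eig[OF generator_integral[OF S that, of z]]
    by (simp add: J_def linear_diff[OF bounded_linear.linear[OF l]])
  have "(J has_field_derivative l z + \<mu> * J s) (at s within {0..t})" if s: "s \<in> {0..t}" for s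
  proof -
    have "((\<lambda>s. integral {0..s} (\<lambda>r. S r z)) has_vector_derivative S s z) (at s within {0..t})"
      using s by (intro integral_has_vector_derivative continuous_on_subset[OF C0_semigroup_continuous[OF S]]) auto
    then have "(J has_vector_derivative l (S s z)) (at s within {0..t})"
      unfolding J_def by (rule bounded_linear.has_vector_derivative[OF l])
    then show ?thesis using G s by (simp add: has_real_derivative_iff_has_vector_derivative)
  qed
  \<comment> \<open>Integrating factor: since the derivative of \<open>J\<close> is
    \<open>l z + \<mu> * J s\<close>, this product is constant.\<close>
  then have "((\<lambda>s. exp (- \<mu> * s) * (l z + \<mu> * J s)) has_field_derivative 0) (at s within {0..t})"
    if "s \<in> {0..t}" for s
    using that by (auto intro!: derivative_eq_intros simp: algebra_simps)
  then obtain k where k: "\<And>s. s \<in> {0..t} \<Longrightarrow> exp (- \<mu> * s) * (l z + \<mu> * J s) = k"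
    using has_field_derivative_zero_constant[of "{0..t}" "\<lambda>s. exp (- \<mu> * s) * (l z + \<mu> * J s)"] by auto
  have "k = l z" using k[of 0] t by (simp add: J_def linear_0[OF bounded_linear.linear[OF l]])
  then have "exp (- (\<mu> * t)) * l (S t z) = l z" using k[of t] G[of t] t by simp
  then show ?thesis by (simp add: exp_minus field_simps)
qed

section \<open>Test functions\<close>

text \<open>The classical function \<open>exp (- 1 / x)\<close> that is smooth but not analytic at
  0. The polynomial factor in \<open>1 / x\<close> makes the family closed under
  differentiation.\<close>

definition flat :: "real poly \<Rightarrow> real \<Rightarrow> real" where
  "flat p x = (if x > 0 then poly p (1 / x) * exp (- 1 / x) else 0)"

lemma poly_times_exp_minus_tendsto_0: "((\<lambda>x. poly p x * exp (- x)) \<longlongrightarrow> 0) (at_top :: real filter)"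
proof -
  have "((\<lambda>x. \<Sum>i\<le>degree p. coeff p i * (x ^ i / exp x)) \<longlongrightarrow> (\<Sum>i\<le>degree p. coeff p i * 0)) at_top"
    by (intro tendsto_intros tendsto_power_div_exp_0)
  then show ?thesis
    by (simp add: poly_altdef sum_distrib_right exp_minus divide_inverse mult.assoc)
qed

text \<open>With \<open>t = 1 / x\<close>, whose derivative is \<open>- t^2\<close>, the derivative
  of \<open>p(t) * exp (- t)\<close> is \<open>t^2 * (p - p')(t) * exp (- t)\<close>; the factor
  \<open>[:0, 0, 1:]\<close> is \<open>t^2\<close>. At 0 the exponential beats every polynomial in
  \<open>1 / x\<close>.\<close>

lemma DERIV_flat:
  "(flat p has_real_derivative flat ([:0, 0, 1:] * (p - pderiv p)) x) (at x)"
proof -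
  let ?q = "[:0, 0, 1:] * (p - pderiv p)"
  consider "x > 0" | "x < 0" | "x = 0" by linarith
  then show ?thesis
  proof cases
    case 1
    have "((\<lambda>x. poly p (1 / x)) has_real_derivative poly (pderiv p) (1 / x) * (- 1 / x\<^sup>2)) (at x)"
      using 1 by (intro DERIV_chain2[OF poly_DERIV]) (auto intro!: derivative_eq_intros simp: power2_eq_square)
    moreover have "((\<lambda>x. exp (- 1 / x)) has_real_derivative exp (- 1 / x) * (1 / x\<^sup>2)) (at x)"
      using 1 by (auto intro!: derivative_eq_intros simp: power2_eq_square)
    ultimately have "((\<lambda>x. poly p (1 / x) * exp (- 1 / x)) has_real_derivative flat ?q x) (at x)"
      by (rule DERIV_mult[THEN DERIV_cong]) (use 1 in \<open>simp add: flat_def field_simps power2_eq_square\<close>)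
    then show ?thesis
      using 1 by (elim DERIV_cong_ev[THEN iffD1, rotated -1])
        (auto simp: flat_def eventually_nhds intro!: exI[of _ "{0<..}"])
  next
    case 2
    have "((\<lambda>x. 0) has_real_derivative flat ?q x) (at x)"
      using 2 by (simp add: flat_def)
    then show ?thesis
      using 2 by (elim DERIV_cong_ev[THEN iffD1, rotated -1])
        (auto simp: flat_def eventually_nhds intro!: exI[of _ "{..<0}"])
  next
    case 3
    have "((\<lambda>h. flat p h / h) \<longlongrightarrow> 0) (at_right 0)"
    proof -
      \<comment> \<open>\<open>pCons 0 p\<close> is \<open>p\<close> times the variable; this
        absorbs the division by \<open>h\<close> in the difference quotient.\<close>
      have "((\<lambda>h. poly (pCons 0 p) (inverse h) * exp (- inverse h)) \<longlongrightarrow> 0) (at_right 0)"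
        by (rule filterlim_compose[OF poly_times_exp_minus_tendsto_0 filterlim_inverse_at_top_right])
      moreover have "\<forall>\<^sub>F h in at_right 0. poly (pCons 0 p) (inverse h) * exp (- inverse h) = flat p h / h"
        using eventually_at_right_less[of 0] by eventually_elim (simp add: flat_def divide_inverse)
      ultimately show ?thesis by (rule Lim_transform_eventually)
    qed
    moreover have "((\<lambda>h. flat p h / h) \<longlongrightarrow> 0) (at_left 0)"
      by (rule Lim_transform_eventually[OF tendsto_const])
         (use eventually_at_left_real[of "-1" 0] in \<open>auto simp: flat_def elim: eventually_mono\<close>)
    ultimately have "((\<lambda>h. flat p h / h) \<longlongrightarrow> 0) (at 0)" by (intro filterlim_split_at)
    then show ?thesis using 3 by (simp add: DERIV_def flat_def)
  qed
qed

text \<open>Closed under differentiation by construction, so membership yields all derivatives at once.\<close>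

inductive_set smooth_funs :: "(real \<Rightarrow> complex) set" where
  const: "(\<lambda>x. c) \<in> smooth_funs"
| sin: "(\<lambda>x. of_real (sin (n * x))) \<in> smooth_funs"
| cos: "(\<lambda>x. of_real (cos (n * x))) \<in> smooth_funs"
| flat: "(\<lambda>x. of_real (flat p (a * x + b))) \<in> smooth_funs"
| add: "f \<in> smooth_funs \<Longrightarrow> g \<in> smooth_funs \<Longrightarrow> (\<lambda>x. f x + g x) \<in> smooth_funs"
| mult: "f \<in> smooth_funs \<Longrightarrow> g \<in> smooth_funs \<Longrightarrow> (\<lambda>x. f x * g x) \<in> smooth_funs"

lemma smooth_funs_derivative:
  "f \<in> smooth_funs \<Longrightarrow> \<exists>f'\<in>smooth_funs. \<forall>x. (f has_vector_derivative f' x) (at x)"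
proof (induction rule: smooth_funs.induct)
  case (const c)
  show ?case using smooth_funs.const[of 0] by (intro bexI[of _ "\<lambda>x. 0"]) auto
next
  case (sin n)
  show ?case
  proof (intro bexI allI)
    show "((\<lambda>x. complex_of_real (sin (n * x))) has_vector_derivative of_real n * of_real (cos (n * x))) (at x)" for x
      unfolding of_real_mult[symmetric]
      by (intro has_vector_derivative_of_real) (auto intro!: derivative_eq_intros)
  qed (intro smooth_funs.intros)
next
  case (cos n)
  show ?case
  proof (intro bexI allI)
    show "((\<lambda>x. complex_of_real (cos (n * x))) has_vector_derivative of_real (- n) * of_real (sin (n * x))) (at x)" for x
      unfolding of_real_mult[symmetric]
      by (intro has_vector_derivative_of_real) (auto intro!: derivative_eq_intros)
  qed (intro smooth_funs.intros)
next
  case (flat p a b)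
  show ?case
  proof (intro bexI allI)
    show "((\<lambda>x. complex_of_real (flat p (a * x + b))) has_vector_derivative
        of_real a * of_real (flat ([:0, 0, 1:] * (p - pderiv p)) (a * x + b))) (at x)" for x
      unfolding of_real_mult[symmetric]
      by (intro has_vector_derivative_of_real DERIV_chain2[OF DERIV_flat, THEN DERIV_cong])
         (auto intro!: derivative_eq_intros simp del: mult_pCons_left)
  qed (intro smooth_funs.intros)
next
  case (add f g)
  then obtain f' g' where *: "f' \<in> smooth_funs" "g' \<in> smooth_funs"
    "\<And>x. (f has_vector_derivative f' x) (at x)" "\<And>x. (g has_vector_derivative g' x) (at x)" by blast
  then show ?case
    by (intro bexI[of _ "\<lambda>x. f' x + g' x"] allI has_vector_derivative_add smooth_funs.intros)
next
  case (mult f g)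
  then obtain f' g' where *: "f' \<in> smooth_funs" "g' \<in> smooth_funs"
    "\<And>x. (f has_vector_derivative f' x) (at x)" "\<And>x. (g has_vector_derivative g' x) (at x)" by blast
  then show ?case
    using mult.hyps
    by (intro bexI[of _ "\<lambda>x. f x * g' x + f' x * g x"] allI has_vector_derivative_mult smooth_funs.intros)
qed

lemma smooth_funs_vderiv: "f \<in> smooth_funs \<Longrightarrow> vderiv f \<in> smooth_funs"
  and smooth_funs_has_vderiv: "f \<in> smooth_funs \<Longrightarrow> (f has_vector_derivative vderiv f x) (at x)"
proof -
  assume "f \<in> smooth_funs"
  then obtain f' where f': "f' \<in> smooth_funs" "\<And>x. (f has_vector_derivative f' x) (at x)"
    using smooth_funs_derivative by blast
  then have "vderiv f = f'" by (simp add: vderiv_def fun_eq_iff vector_derivative_at)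
  with f' show "vderiv f \<in> smooth_funs" "(f has_vector_derivative vderiv f x) (at x)" by auto
qed

lemma test_functionI:
  assumes "f \<in> smooth_funs" "a > 0" "b < pi" "\<And>x. f x \<noteq> 0 \<Longrightarrow> a \<le> x \<and> x \<le> b"
  shows "test_function f"
proof -
  have "(vderiv ^^ k) f \<in> smooth_funs" for k
    by (induction k) (auto intro: smooth_funs_vderiv assms(1))
  then have "(vderiv ^^ k) f differentiable (at x)" for k x
    using smooth_funs_has_vderiv differentiableI_vector by blast
  moreover have "closure {x. f x \<noteq> 0} \<subseteq> {a..b}"
    by (rule closure_minimal) (use assms(4) in auto)
  ultimately show ?thesis using assms(2,3) unfolding test_function_def by fastforce
qed

lemma test_function_has_vderiv:
  assumes "test_function f"
  shows "(f has_vector_derivative vderiv f x) (at x)"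
proof -
  have "(vderiv ^^ 0) f differentiable (at x)" using assms unfolding test_function_def by blast
  then show ?thesis by (simp add: vderiv_def vector_derivative_works)
qed

text \<open>Off the closed support \<open>f\<close> vanishes on an open set, so its derivative
  vanishes there too. This lets derivatives of test functions serve as test functions
  themselves.\<close>

lemma test_function_vderiv:
  assumes "test_function f"
  shows "test_function (vderiv f)"
proof -
  have "(vderiv ^^ k) (vderiv f) differentiable (at x)" for k x
    using assms unfolding test_function_def
    by (metis comp_apply funpow_Suc_right)
  moreover have "{x. vderiv f x \<noteq> 0} \<subseteq> closure {x. f x \<noteq> 0}"
  proof
    fix x assume "x \<in> {x. vderiv f x \<noteq> 0}"
    show "x \<in> closure {x. f x \<noteq> 0}"
    proof (rule ccontr)
      assume x: "x \<notin> closure {x. f x \<noteq> 0}"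
      have "(f has_vector_derivative 0) (at x)"
      proof (rule has_vector_derivative_transform_within_open)
        show "((\<lambda>_. 0) has_vector_derivative 0) (at x)" by simp
        show "open (- closure {x. f x \<noteq> 0})" by auto
        show "0 = f y" if "y \<in> - closure {x. f x \<noteq> 0}" for y
          using that closure_subset[of "{x. f x \<noteq> 0}"] by auto
      qed (use x in auto)
      then show False using \<open>x \<in> _\<close> by (simp add: vderiv_def vector_derivative_at)
    qed
  qed
  then have "closure {x. vderiv f x \<noteq> 0} \<subseteq> closure {x. f x \<noteq> 0}"
    by (rule closure_minimal) simp
  ultimately show ?thesis using assms unfolding test_function_def by blast
qed

lemma test_function_vanishes:
  assumes "test_function f" "x \<le> 0 \<or> x \<ge> pi"
  shows "f x = 0"
  using assms closure_subset[of "{x. f x \<noteq> 0}"] unfolding test_function_def by fastforce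

lemma test_function_continuous:
  assumes "test_function f"
  shows "continuous_on A f"
  using test_function_has_vderiv[OF assms] has_vector_derivative_continuous
  by (intro continuous_at_imp_continuous_on) blast

section \<open>Bounds and limits for the cutoff profile and its derivative\<close>

lemma flat_1_bounds: "0 \<le> flat 1 y" "flat 1 y \<le> 1"
  by (auto simp: flat_def)

lemma flat_1_tendsto_1: "(flat 1 \<longlongrightarrow> 1) at_top"
proof -
  have "((\<lambda>y::real. exp (- 1 / y)) \<longlongrightarrow> exp 0) at_top"
    by (intro tendsto_exp tendsto_divide_0[OF tendsto_const] filterlim_at_top_imp_at_infinity filterlim_ident)
  moreover have "\<forall>\<^sub>F y in at_top. exp (- 1 / y) = flat 1 y"
    using eventually_gt_at_top[of 0] by eventually_elim (simp add: flat_def)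
  ultimately show ?thesis by (auto intro: Lim_transform_eventually)
qed

text \<open>The derivative of \<open>flat 1\<close>: the polynomial of \<open>DERIV_flat\<close> for
  the constant polynomial 1.\<close>

abbreviation flat' :: "real \<Rightarrow> real" where "flat' \<equiv> flat [:0, 0, 1:]"

text \<open>The weight \<open>y + 1\<close> is the scaled distance to the boundary: at
  \<open>y = (k + 1) * x - 1\<close> the product equals \<open>x\<close> times the derivative of the
  cutoff \<open>flat 1 ((k + 1) * x - 1)\<close>.\<close>

lemma flat'_bounds: "0 \<le> flat' y" "(y + 1) * flat' y \<le> 2"
proof -
  show "0 \<le> flat' y" by (simp add: flat_def)
  show "(y + 1) * flat' y \<le> 2"
  proof (cases "y > 0")
    case True
    \<comment> \<open>In terms of \<open>t = 1 / y\<close> the product is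
      \<open>(t + t^2) * exp (- t)\<close>, and the quadratic Taylor bound gives
      \<open>t + t^2 \<le> 2 * exp t\<close>.\<close>
    define t where "t = 1 / y"
    have t: "t > 0" "y = 1 / t" using True by (auto simp: t_def)
    have "t + t\<^sup>2 \<le> 2 * exp t"
      using exp_lower_Taylor_quadratic[of t] t by simp
    moreover have "(y + 1) * flat' y = (t + t\<^sup>2) * exp (- t)"
      using t by (simp add: flat_def) (simp add: field_simps power2_eq_square)
    ultimately have "(y + 1) * flat' y \<le> 2 * exp t * exp (- t)"
      by (simp add: mult_right_mono)
    then show ?thesis by (simp add: mult.assoc flip: exp_add)
  qed (simp add: flat_def)
qed

lemma flat'_tendsto_0: "((\<lambda>y. (y + 1) * flat' y) \<longlongrightarrow> 0) at_top"
proof -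
  have inv: "((\<lambda>y::real. inverse y) \<longlongrightarrow> 0) at_top"
    by (rule tendsto_inverse_0_at_top[OF filterlim_ident])
  have "((\<lambda>y::real. (inverse y + inverse y * inverse y) * exp (- inverse y)) \<longlongrightarrow> (0 + 0 * 0) * exp (- 0)) at_top"
    by (intro tendsto_intros inv)
  moreover have "\<forall>\<^sub>F y in at_top. (inverse y + inverse y * inverse y) * exp (- inverse y) = (y + 1) * flat' y"
    using eventually_gt_at_top[of 0]
    by eventually_elim (simp add: flat_def field_simps power2_eq_square)
  ultimately show ?thesis by (auto intro: Lim_transform_eventually)
qed

section \<open>Integrals over the open interval and the trigonometric elements of
  \<open>L2\<close>\<close>

lemma
  assumes "continuous_on {0..pi} f"
  shows continuous_imp_sq_integrable: "sq_integrable f"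
    and continuous_imp_integrable: "integrable I_pi f"
    and LINT_eq_integral: "(LINT x|I_pi. f x) = integral {0..pi} f"
proof -
  obtain B where B: "\<And>x. x \<in> {0..pi} \<Longrightarrow> cmod (f x) \<le> B"
    using compact_imp_bounded[OF compact_continuous_image[OF assms compact_Icc]]
    by (force simp: bounded_iff)
  interpret finite_measure I_pi by (rule finite_measure_lebesgue_on) simp
  have meas: "f \<in> borel_measurable I_pi"
    by (intro continuous_imp_measurable_on_sets_lebesgue continuous_on_subset[OF assms]) auto
  show "sq_integrable f"
  proof (rule sq_integrable_bound[OF meas])
    show "integrable I_pi (\<lambda>x. B\<^sup>2)" by simp
    show "AE x in I_pi. (cmod (f x))\<^sup>2 \<le> B\<^sup>2"
      using B by (intro AE_I2 power_mono) auto
  qed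
  show int: "integrable I_pi f"
    by (rule integrable_const_bound[OF _ meas, of B]) (use B in auto)
  \<comment> \<open>The end points are negligible, so the fundamental theorem of calculus on the
    closed interval becomes available for the Lebesgue integral.\<close>
  show "(LINT x|I_pi. f x) = integral {0..pi} f"
    using lebesgue_integral_eq_integral[OF int] integral_open_interval_real[of 0 pi f] by simp
qed

lemma inner_to_L2:
  "sq_integrable f \<Longrightarrow> sq_integrable g \<Longrightarrow> to_L2 f \<bullet> to_L2 g = Re (LINT x|I_pi. f x * cnj (g x))"
  by (simp add: inner_L2.abs_eq)

lemma inner_to_L2_right:
  "sq_integrable g \<Longrightarrow> u \<bullet> to_L2 g = Re (LINT x|I_pi. fun_of u x * cnj (g x))"
  using inner_to_L2[OF sq_integrable_fun_of, of g u] by (simp add: to_L2_fun_of)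

definition sin_L2 :: "nat \<Rightarrow> L2" where
  "sin_L2 n = to_L2 (\<lambda>x. of_real (sin (n * x)))"

definition cos_L2 :: "nat \<Rightarrow> L2" where
  "cos_L2 n = to_L2 (\<lambda>x. of_real (cos (n * x)))"

lemma sq_integrable_sin: "sq_integrable (\<lambda>x. of_real (sin (c * x)))"
  and sq_integrable_cos: "sq_integrable (\<lambda>x. of_real (cos (c * x)))"
  by (intro continuous_imp_sq_integrable continuous_intros)+

lemma test_function_sq_integrable: "test_function f \<Longrightarrow> sq_integrable f"
  by (intro continuous_imp_sq_integrable test_function_continuous)

lemma vderiv_Reals:
  assumes "test_function f" "\<And>x. f x \<in> \<real>"
  shows "vderiv f x \<in> \<real>"
proof -
  have "(\<lambda>x. cnj (f x)) = f" using assms(2) by (simp add: fun_eq_iff Reals_cnj_iff)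
  then have "(f has_vector_derivative cnj (vderiv f x)) (at x)"
    using bounded_linear.has_vector_derivative[OF bounded_linear_cnj test_function_has_vderiv[OF assms(1), of x]]
    by simp
  then have "cnj (vderiv f x) = vderiv f x"
    using vector_derivative_unique_at test_function_has_vderiv[OF assms(1)] by blast
  then show ?thesis by (simp add: Reals_cnj_iff)
qed

text \<open>The inner product conjugates its second argument and \<open>has_weak_derivative\<close>
  does not; for real-valued test functions the two pairings agree up to taking real parts.\<close>

lemma has_weak_derivative_inner:
  assumes "has_weak_derivative u v" "test_function f" "\<And>x. f x \<in> \<real>"
  shows "u \<bullet> to_L2 (vderiv f) = - (v \<bullet> to_L2 f)"
proof -
  have "cnj (f x) = f x" "cnj (vderiv f x) = vderiv f x" for x
    using assms vderiv_Reals by (simp_all add: Reals_cnj_iff)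
  moreover have "sq_integrable f" "sq_integrable (vderiv f)"
    using assms(2) by (auto intro: test_function_sq_integrable test_function_vderiv)
  ultimately show ?thesis
    using assms(1,2) by (simp add: inner_to_L2_right has_weak_derivative_def)
qed

section \<open>Approximation of sines by test functions together with the derivatives\<close>

lemma abs_sin_nat_le:
  assumes "x \<in> {0<..<pi}"
  shows "\<bar>sin (real n * x)\<bar> \<le> n * x" "\<bar>sin (real n * x)\<bar> \<le> n * (pi - x)"
proof -
  show "\<bar>sin (real n * x)\<bar> \<le> n * x"
    using abs_sin_x_le_abs_x[of "n * x"] assms by simp
  have "sin (n * (pi - x)) = - (cos (n * pi) * sin (n * x))"
    by (simp add: right_diff_distrib sin_diff)
  then have "\<bar>sin (n * (pi - x))\<bar> = \<bar>sin (n * x)\<bar>"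
    by (simp add: abs_mult)
  then show "\<bar>sin (real n * x)\<bar> \<le> n * (pi - x)"
    using abs_sin_x_le_abs_x[of "n * (pi - x)"] assms by simp
qed

text \<open>
  The cutoffs have unbounded derivatives near the end points, but there \<open>\<bar>sin (n x)\<bar>\<close> is at most
  \<open>n\<close> times the distance to the boundary, which keeps the products bounded.
\<close>

lemma sin_test_function_approximation:
  obtains \<phi> where "\<And>k::nat. test_function (\<phi> k)" "\<And>k x. \<phi> k x \<in> \<real>"
    "(\<lambda>k. to_L2 (\<phi> k)) \<longlonglongrightarrow> sin_L2 n"
    "(\<lambda>k. to_L2 (vderiv (\<phi> k))) \<longlonglongrightarrow> real n *\<^sub>R cos_L2 n"
proof
  \<comment> \<open>\<open>l k\<close> vanishes up to \<open>1 / (k + 1)\<close> and tends to 1 at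
    every positive point; \<open>l k (pi - x)\<close> is its mirror image at the other end.
    \<open>l' k\<close> is the derivative of \<open>l k\<close>, and \<open>\<phi>' k\<close> that
    of \<open>\<phi> k\<close> by the product rule.\<close>
  define l where "l k x = flat 1 (real (Suc k) * x + - 1)" for k and x :: real
  define l' where "l' k x = real (Suc k) * flat' (real (Suc k) * x + - 1)" for k and x :: real
  define \<phi> where "\<phi> k x = complex_of_real (sin (real n * x) * (l k x * l k (pi - x)))" for k and x :: real
  define \<phi>' where "\<phi>' k x = real n * cos (real n * x) * (l k x * l k (pi - x))
      + sin (real n * x) * l' k x * l k (pi - x) - sin (real n * x) * l' k (pi - x) * l k x" for k and x :: real
  have l_bd: "0 \<le> l k x" "l k x \<le> 1" for k x
    by (simp_all add: l_def flat_1_bounds)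
  have at_top: "filterlim (\<lambda>k. real (Suc k) * x + - 1) at_top sequentially" if "x > 0" for x :: real
    using that by real_asymp
  have l_lim: "(\<lambda>k. l k x) \<longlonglongrightarrow> 1" if "x > 0" for x
    unfolding l_def by (rule filterlim_compose[OF flat_1_tendsto_1 at_top[OF that]])
  have l'_bd: "0 \<le> l' k x" "x * l' k x \<le> 2" for k x
    using flat'_bounds[of "real (Suc k) * x + - 1"] by (auto simp: l'_def algebra_simps)
  have l'_lim: "(\<lambda>k. l' k x) \<longlonglongrightarrow> 0" if "x > 0" for x
    using tendsto_mult_left[OF filterlim_compose[OF flat'_tendsto_0 at_top[OF that]], of "1 / x"] that
    by (simp add: l'_def)
  \<comment> \<open>The mirrored argument is brought to the affine form that the rule
    \<open>flat\<close> of \<open>smooth_funs\<close> expects.\<close>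
  have affine: "real (Suc k) * (pi - x) + - 1 = - real (Suc k) * x + (real (Suc k) * pi - 1)" for k x
    by (simp add: algebra_simps)
  have smooth: "\<phi> k \<in> smooth_funs" for k
    unfolding \<phi>_def l_def affine of_real_mult by (intro smooth_funs.intros)
  show test: "test_function (\<phi> k)" for k
  proof (rule test_functionI[OF smooth, of "1 / Suc k" "pi - 1 / Suc k"])
    fix x assume "\<phi> k x \<noteq> 0"
    then have "real (Suc k) * x > 1" "real (Suc k) * (pi - x) > 1"
      by (auto simp: \<phi>_def l_def flat_def algebra_simps split: if_splits)
    then show "1 / Suc k \<le> x \<and> x \<le> pi - 1 / Suc k"
      by (auto simp: field_simps)
  qed auto
  show "\<phi> k x \<in> \<real>" for k x by (simp add: \<phi>_def)
  have vd: "vderiv (\<phi> k) = (\<lambda>x. of_real (\<phi>' k x))" for k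
  proof
    fix x
    have l: "(l k has_real_derivative l' k x) (at x)" for x
      unfolding l_def l'_def by (rule DERIV_chain2[OF DERIV_flat, THEN DERIV_cong])
        (auto intro!: derivative_eq_intros)
    have r: "((\<lambda>x. l k (pi - x)) has_real_derivative l' k (pi - x) * - 1) (at x)"
      by (rule DERIV_chain2[OF l]) (auto intro!: derivative_eq_intros)
    have "(\<phi> k has_vector_derivative of_real (\<phi>' k x)) (at x)"
      unfolding \<phi>_def \<phi>'_def
      by (intro has_vector_derivative_of_real)
         (auto intro!: derivative_eq_intros l r simp: algebra_simps)
    then show "vderiv (\<phi> k) x = of_real (\<phi>' k x)"
      by (simp add: vderiv_def vector_derivative_at)
  qed
  show "(\<lambda>k. to_L2 (\<phi> k)) \<longlonglongrightarrow> sin_L2 n"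
    unfolding sin_L2_def
  proof (rule to_L2_tendsto_dominated)
    show "\<phi> k \<in> borel_measurable I_pi" for k
      by (rule sq_integrableD(1)[OF test_function_sq_integrable[OF test]])
    show "sq_integrable (\<lambda>x. 1)" by (rule sq_integrable_const)
    show "AE x in I_pi. (\<lambda>k. \<phi> k x) \<longlonglongrightarrow> of_real (sin (n * x))"
    proof (rule AE_I2)
      fix x assume "x \<in> space I_pi"
      then have "(\<lambda>k. complex_of_real (sin (real n * x) * (l k x * l k (pi - x)))) \<longlonglongrightarrow> of_real (sin (n * x) * (1 * 1))"
        by (intro tendsto_intros l_lim) auto
      then show "(\<lambda>k. \<phi> k x) \<longlonglongrightarrow> of_real (sin (n * x))" by (simp add: \<phi>_def)
    qed
    show "AE x in I_pi. cmod (\<phi> k x) \<le> cmod 1" for k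
      unfolding \<phi>_def norm_of_real abs_mult norm_one
      by (intro AE_I2 mult_le_one mult_nonneg_nonneg) (auto simp: l_bd)
  qed (rule sq_integrable_sin)
  have "(\<lambda>k. to_L2 (vderiv (\<phi> k))) \<longlonglongrightarrow> to_L2 (\<lambda>x. real n *\<^sub>R of_real (cos (n * x)))"
  proof (rule to_L2_tendsto_dominated)
    show "vderiv (\<phi> k) \<in> borel_measurable I_pi" for k
      by (rule sq_integrableD(1)[OF test_function_sq_integrable[OF test_function_vderiv[OF test]]])
    \<comment> \<open>The dominating constant is \<open>n\<close> for the cosine term plus
      \<open>2 * n\<close> for each of the two terms that contain a derivative of the
      cutoff.\<close>
    show "sq_integrable (\<lambda>x. of_real (5 * n))" by (rule sq_integrable_const)
    show "AE x in I_pi. (\<lambda>k. vderiv (\<phi> k) x) \<longlonglongrightarrow> real n *\<^sub>R of_real (cos (n * x))"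
    proof (rule AE_I2)
      fix x assume "x \<in> space I_pi"
      then have "(\<lambda>k. complex_of_real (\<phi>' k x)) \<longlonglongrightarrow>
         of_real (n * cos (n * x) * (1 * 1) + sin (n * x) * 0 * 1 - sin (n * x) * 0 * 1)"
        unfolding \<phi>'_def
        by (intro tendsto_intros l_lim l'_lim) auto
      then show "(\<lambda>k. vderiv (\<phi> k) x) \<longlonglongrightarrow> real n *\<^sub>R of_real (cos (n * x))"
        by (simp add: vd scaleR_conv_of_real)
    qed
    show "AE x in I_pi. cmod (vderiv (\<phi> k) x) \<le> cmod (of_real (5 * n))" for k
    proof (rule AE_I2)
      fix x assume "x \<in> space I_pi"
      then have x: "x \<in> {0<..<pi}" by simp
      have "\<bar>n * cos (n * x) * (l k x * l k (pi - x))\<bar> \<le> real n * 1 * (1 * 1)"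
        unfolding abs_mult using l_bd by (intro mult_mono mult_nonneg_nonneg) auto
      moreover have "\<bar>sin (n * x) * l' k x * l k (pi - x)\<bar> \<le> real n * 2 * 1"
        unfolding abs_mult
      proof (rule mult_mono)
        have "\<bar>sin (n * x)\<bar> * \<bar>l' k x\<bar> \<le> n * x * \<bar>l' k x\<bar>"
          by (intro mult_right_mono abs_sin_nat_le x) auto
        also have "\<dots> = n * (x * l' k x)" by (simp add: l'_bd)
        also have "\<dots> \<le> real n * 2" using l'_bd by (simp add: mult_left_mono)
        finally show "\<bar>sin (n * x)\<bar> * \<bar>l' k x\<bar> \<le> real n * 2" .
      qed (use l_bd in auto)
      moreover have "\<bar>sin (n * x) * l' k (pi - x) * l k x\<bar> \<le> real n * 2 * 1"
        unfolding abs_mult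
      proof (rule mult_mono)
        have "\<bar>sin (n * x)\<bar> * \<bar>l' k (pi - x)\<bar> \<le> n * (pi - x) * \<bar>l' k (pi - x)\<bar>"
          by (intro mult_right_mono abs_sin_nat_le x) auto
        also have "\<dots> = n * ((pi - x) * l' k (pi - x))" by (simp add: l'_bd)
        also have "\<dots> \<le> real n * 2" using l'_bd by (simp add: mult_left_mono)
        finally show "\<bar>sin (n * x)\<bar> * \<bar>l' k (pi - x)\<bar> \<le> real n * 2" .
      qed (use l_bd in auto)
      ultimately have "\<bar>\<phi>' k x\<bar> \<le> 5 * n" unfolding \<phi>'_def by linarith
      then show "cmod (vderiv (\<phi> k) x) \<le> cmod (of_real (5 * n))" by (simp add: vd)
    qed
    show "sq_integrable (\<lambda>x. real n *\<^sub>R complex_of_real (cos (n * x)))"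
      by (intro sq_integrable_scaleR sq_integrable_cos)
  qed
  then show "(\<lambda>k. to_L2 (vderiv (\<phi> k))) \<longlonglongrightarrow> real n *\<^sub>R cos_L2 n"
    by (simp add: cos_L2_def scaleR_to_L2 sq_integrable_cos)
qed

section \<open>Pairing weak derivatives with sines and cosines\<close>

text \<open>Since \<open>sin (n x)\<close> vanishes at both ends it is a limit of test functions
  with convergent derivatives, so no boundary term arises although \<open>u\<close> satisfies no
  boundary condition.\<close>

lemma inner_sin_L2_weak_derivative:
  assumes "has_weak_derivative u v"
  shows "v \<bullet> sin_L2 n = - (real n * (u \<bullet> cos_L2 n))"
proof -
  obtain \<phi> where \<phi>: "\<And>k::nat. test_function (\<phi> k)" "\<And>k x. \<phi> k x \<in> \<real>"
    "(\<lambda>k. to_L2 (\<phi> k)) \<longlonglongrightarrow> sin_L2 n"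
    "(\<lambda>k. to_L2 (vderiv (\<phi> k))) \<longlonglongrightarrow> real n *\<^sub>R cos_L2 n"
    by (rule sin_test_function_approximation[of n]) blast
  have "(\<lambda>k. v \<bullet> to_L2 (\<phi> k)) \<longlonglongrightarrow> v \<bullet> sin_L2 n"
    by (intro tendsto_intros \<phi>)
  moreover have "v \<bullet> to_L2 (\<phi> k) = - (u \<bullet> to_L2 (vderiv (\<phi> k)))" for k
    using has_weak_derivative_inner[OF assms \<phi>(1,2)] by simp
  moreover have "(\<lambda>k. - (u \<bullet> to_L2 (vderiv (\<phi> k)))) \<longlonglongrightarrow> - (u \<bullet> (real n *\<^sub>R cos_L2 n))"
    by (intro tendsto_intros \<phi>)
  ultimately show ?thesis using LIMSEQ_unique by fastforce
qed

text \<open>The membership in \<open>H1_0\<close> and the system operator each supply a weak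
  derivative of \<open>u\<close>; this identifies their cosine coefficients. Both pair equally with
  the test functions \<open>vderiv (\<phi> k)\<close>, which tend to \<open>n\<close> times the
  cosine.\<close>

lemma inner_cos_L2_weak_derivative_unique:
  assumes "has_weak_derivative u v" "has_weak_derivative u w" "n > 0"
  shows "v \<bullet> cos_L2 n = w \<bullet> cos_L2 n"
proof -
  obtain \<phi> where \<phi>: "\<And>k::nat. test_function (\<phi> k)" "\<And>k x. \<phi> k x \<in> \<real>"
    "(\<lambda>k. to_L2 (\<phi> k)) \<longlonglongrightarrow> sin_L2 n"
    "(\<lambda>k. to_L2 (vderiv (\<phi> k))) \<longlonglongrightarrow> real n *\<^sub>R cos_L2 n"
    by (rule sin_test_function_approximation[of n]) blast
  have "v \<bullet> to_L2 (vderiv (\<phi> k)) = w \<bullet> to_L2 (vderiv (\<phi> k))" for k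
    using has_weak_derivative_inner[OF assms(1) test_function_vderiv[OF \<phi>(1)[of k]] vderiv_Reals[OF \<phi>(1,2)]]
      has_weak_derivative_inner[OF assms(2) test_function_vderiv[OF \<phi>(1)[of k]] vderiv_Reals[OF \<phi>(1,2)]]
    by simp
  moreover have "(\<lambda>k. v \<bullet> to_L2 (vderiv (\<phi> k))) \<longlonglongrightarrow> v \<bullet> (real n *\<^sub>R cos_L2 n)"
    "(\<lambda>k. w \<bullet> to_L2 (vderiv (\<phi> k))) \<longlonglongrightarrow> w \<bullet> (real n *\<^sub>R cos_L2 n)"
    by (intro tendsto_intros \<phi>)+
  ultimately have "v \<bullet> (real n *\<^sub>R cos_L2 n) = w \<bullet> (real n *\<^sub>R cos_L2 n)"
    using LIMSEQ_unique by fastforce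
  then show ?thesis using assms(3) by simp
qed

text \<open>Integration by parts: the cosine does not vanish at the end points, but \<open>f\<close>
  does.\<close>

lemma test_function_inner_cos_L2:
  assumes f: "test_function f"
  shows "to_L2 (vderiv f) \<bullet> cos_L2 n = real n * (to_L2 f \<bullet> sin_L2 n)"
proof -
  define c s :: "real \<Rightarrow> complex" where "c x = of_real (cos (real n * x))"
    and "s x = of_real (sin (real n * x))" for x
  have cont: "continuous_on {0..pi} f" "continuous_on {0..pi} (vderiv f)"
      "continuous_on {0..pi} c" "continuous_on {0..pi} s"
    unfolding c_def s_def
    by (intro test_function_continuous test_function_vderiv f continuous_intros)+
  have d: "((\<lambda>x. f x * c x) has_vector_derivative vderiv f x * c x - of_real n * (f x * s x)) (at x)" for x
  proof -
    have "(c has_vector_derivative of_real (- (n * sin (n * x)))) (at x)"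
      unfolding c_def by (intro has_vector_derivative_of_real) (auto intro!: derivative_eq_intros)
    from has_vector_derivative_mult[OF test_function_has_vderiv[OF f] this] show ?thesis
      by (simp add: s_def algebra_simps)
  qed
  have "((\<lambda>x. vderiv f x * c x - of_real n * (f x * s x)) has_integral (f pi * c pi - f 0 * c 0)) {0..pi}"
    by (intro fundamental_theorem_of_calculus has_vector_derivative_at_within[OF d]) simp
  then have "integral {0..pi} (\<lambda>x. vderiv f x * c x - of_real n * (f x * s x)) = 0"
    using test_function_vanishes[OF f] by (simp add: integral_unique)
  then have "(LINT x|I_pi. vderiv f x * c x - of_real n * (f x * s x)) = 0"
    by (subst LINT_eq_integral) (auto intro!: continuous_intros cont)
  moreover have "integrable I_pi (\<lambda>x. vderiv f x * c x)" "integrable I_pi (\<lambda>x. f x * s x)"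
    by (intro continuous_imp_integrable continuous_intros cont)+
  ultimately have "(LINT x|I_pi. vderiv f x * c x) = of_real n * (LINT x|I_pi. f x * s x)" by simp
  moreover have "to_L2 (vderiv f) \<bullet> cos_L2 n = Re (LINT x|I_pi. vderiv f x * c x)"
    unfolding cos_L2_def c_def
    by (simp add: inner_to_L2 test_function_sq_integrable test_function_vderiv f sq_integrable_cos)
  moreover have "to_L2 f \<bullet> sin_L2 n = Re (LINT x|I_pi. f x * s x)"
    unfolding sin_L2_def s_def
    by (simp add: inner_to_L2 test_function_sq_integrable f sq_integrable_sin)
  ultimately show ?thesis by simp
qed

text \<open>The identity is a closed condition on the pair of \<open>u\<close> and its derivative,
  so it passes from test functions to their closure. This is where the boundary condition on the
  velocity enters.\<close>

lemma H1_0_inner_cos_L2: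
  assumes "u \<in> H1_0" "has_weak_derivative u v" "n > 0"
  shows "v \<bullet> cos_L2 n = real n * (u \<bullet> sin_L2 n)"
proof -
  obtain w where w: "has_weak_derivative u w"
    "(u, w) \<in> closure {(to_L2 \<phi>, to_L2 (vderiv \<phi>)) | \<phi>. test_function \<phi>}"
    using assms(1) by (auto simp: H1_0_def)
  have "closed {z :: L2 \<times> L2. snd z \<bullet> cos_L2 n = real n * (fst z \<bullet> sin_L2 n)}"
    by (intro closed_Collect_eq continuous_intros)
  then have "closure {(to_L2 \<phi>, to_L2 (vderiv \<phi>)) | \<phi>. test_function \<phi>}
      \<subseteq> {z. snd z \<bullet> cos_L2 n = real n * (fst z \<bullet> sin_L2 n)}"
    by (intro closure_minimal) (auto simp: test_function_inner_cos_L2)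
  then have "w \<bullet> cos_L2 n = real n * (u \<bullet> sin_L2 n)" using w(2) by auto
  then show ?thesis using inner_cos_L2_weak_derivative_unique[OF assms(2) w(1) assms(3)] by simp
qed

section \<open>Orthogonality, norms and mean values of the trigonometric elements\<close>

lemma integral_cos:
  assumes "k \<in> \<int>"
  shows "integral {0..pi} (\<lambda>x. complex_of_real (cos (k * x))) = (if k = 0 then pi else 0)"
proof (cases "k = 0")
  case False
  obtain i where "k = of_int i" using assms by (rule Ints_cases)
  then have "sin (k * pi) = 0" unfolding sin_zero_iff_int2 by blast
  moreover have "((\<lambda>x. complex_of_real (cos (k * x))) has_integral
      of_real (sin (k * pi) / k) - of_real (sin (k * 0) / k)) {0..pi}"
  proof (rule fundamental_theorem_of_calculus[OF _ has_vector_derivative_at_within])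
    show "((\<lambda>x. complex_of_real (sin (k * x) / k)) has_vector_derivative of_real (cos (k * x))) (at x)" for x
      by (rule has_vector_derivative_of_real,
          rule DERIV_cdivide[OF DERIV_chain2[OF DERIV_sin DERIV_cmult_Id], THEN DERIV_cong])
         (use False in simp)
  qed simp
  ultimately show ?thesis using False by (simp add: integral_unique)
qed (simp add: scaleR_conv_of_real)

lemma LINT_cos:
  assumes "k \<in> \<int>"
  shows "(LINT x|I_pi. complex_of_real (cos (k * x))) = (if k = 0 then pi else 0)"
  by (subst LINT_eq_integral) (auto simp: integral_cos[OF assms] intro!: continuous_intros)

lemma cos_L2_orthogonal:
  assumes "m > 0" "n > 0"
  shows "cos_L2 m \<bullet> cos_L2 n = (if m = n then pi / 2 else 0)"
proof -
  let ?c = "\<lambda>k x. complex_of_real (cos (k * x))"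
  have *: "(real m - real n) \<in> \<int>" "(real m + real n) \<in> \<int>" by auto
  have int: "integrable I_pi (?c k)" for k
    by (intro continuous_imp_integrable continuous_intros)
  have eq: "?c (real m) x * cnj (?c (real n) x) = (?c (real m - real n) x + ?c (real m + real n) x) / 2" for x
    by (simp add: cos_times_cos flip: of_real_mult of_real_add) (simp add: algebra_simps)
  have "cos_L2 m \<bullet> cos_L2 n = Re (LINT x|I_pi. (?c (real m - real n) x + ?c (real m + real n) x) / 2)"
    unfolding cos_L2_def by (simp only: inner_to_L2 sq_integrable_cos eq)
  also have "\<dots> = Re (((LINT x|I_pi. ?c (real m - real n) x) + (LINT x|I_pi. ?c (real m + real n) x)) / 2)"
    using int by simp
  also have "\<dots> = (if m = n then pi / 2 else 0)"
    unfolding LINT_cos[OF *(1)] LINT_cos[OF *(2)] using assms by auto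
  finally show ?thesis .
qed

lemma norm_to_L2_le:
  assumes "sq_integrable f" "\<And>x. cmod (f x) \<le> 1"
  shows "norm (to_L2 f) \<le> sqrt pi"
proof -
  interpret finite_measure I_pi by (rule finite_measure_lebesgue_on) simp
  have "(LINT x|I_pi. (cmod (f x))\<^sup>2) \<le> (LINT x|I_pi. 1)"
    using assms by (intro integral_mono) (auto simp: sq_integrable_def power_le_one)
  also have "\<dots> = pi" by (simp add: measure_restrict_space)
  finally show ?thesis using assms(1) by (simp add: norm_to_L2)
qed

lemma norm_cos_L2_le: "norm (cos_L2 n) \<le> sqrt pi"
  and norm_sin_L2_le: "norm (sin_L2 n) \<le> sqrt pi"
  unfolding cos_L2_def sin_L2_def
  by (rule norm_to_L2_le[OF sq_integrable_cos], simp) (rule norm_to_L2_le[OF sq_integrable_sin], simp)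

lemma cos_L2_inner_const:
  assumes "n > 0"
  shows "cos_L2 n \<bullet> to_L2 (\<lambda>x. c) = 0"
proof -
  have "(LINT x|I_pi. complex_of_real (cos (real n * x)) * cnj c) = 0"
    using LINT_cos[of "real n"] assms by simp
  then show ?thesis
    unfolding cos_L2_def by (subst inner_to_L2) (auto simp: sq_integrable_cos sq_integrable_const)
qed

text \<open>The inner product of \<open>L2\<close> is real; the constants 1 and \<open>\<i>\<close>
  recover the real and the imaginary part of the mean.\<close>

lemma L2_mean_zeroI:
  assumes "\<And>c. u \<bullet> to_L2 (\<lambda>x. c) = 0"
  shows "u \<in> L2_mean_zero"
proof -
  have "Re (LINT x|I_pi. fun_of u x * cnj c) = 0" for c
    using assms[of c] by (simp add: inner_to_L2_right sq_integrable_const)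
  then have "Re ((LINT x|I_pi. fun_of u x) * cnj c) = 0" for c by simp
  from this[of 1] this[of \<i>] show ?thesis
    by (simp add: L2_mean_zero_def complex_eq_iff)
qed

section \<open>Adjoint eigenvectors and the cost of control\<close>

text \<open>By orthogonality the coefficient of the lacunary series at \<open>n = 4 ^ j\<close> is
  \<open>(pi / 2) / 2 ^ j\<close>, of order \<open>1 / sqrt n\<close>, hence not
  \<open>O(1 / n)\<close>.\<close>

lemma ex_mean_zero_slow_cos_coefficients:
  "\<exists>u\<in>L2_mean_zero. \<forall>K. \<exists>n>0. \<bar>u \<bullet> cos_L2 n\<bar> > K / real n"
proof
  define f where "f k = (1 / 2) ^ k *\<^sub>R cos_L2 (4 ^ k)" for k :: nat
  have "summable (\<lambda>k. norm (f k))"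
  proof (rule summable_comparison_test)
    show "summable (\<lambda>k. (1 / 2) ^ k * sqrt pi)" by (intro summable_mult2 summable_geometric) simp
    show "\<exists>N. \<forall>n\<ge>N. norm (norm (f n)) \<le> (1 / 2) ^ n * sqrt pi"
      by (auto simp: f_def intro!: mult_left_mono norm_cos_L2_le)
  qed
  then have sum: "summable f" by (rule summable_norm_cancel)
  have inner: "suminf f \<bullet> w = (\<Sum>k. f k \<bullet> w)" for w
    using bounded_linear.suminf[OF bounded_linear_inner_left sum] by simp
  show "suminf f \<in> L2_mean_zero"
    by (rule L2_mean_zeroI) (simp add: inner f_def cos_L2_inner_const)
  show "\<forall>K. \<exists>n>0. \<bar>suminf f \<bullet> cos_L2 n\<bar> > K / real n"
  proof
    fix K :: real
    \<comment> \<open>The claim at \<open>n = 4 ^ j\<close> reads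
      \<open>K / 4 ^ j < (pi / 2) / 2 ^ j\<close>, which is this inequality.\<close>
    obtain j :: nat where j: "2 * K / pi < 2 ^ j" using real_arch_pow[of 2] by auto
    have "f k \<bullet> cos_L2 (4 ^ j) = (if k = j then (1 / 2) ^ j * (pi / 2) else 0)" for k
      by (auto simp: f_def cos_L2_orthogonal)
    then have "suminf f \<bullet> cos_L2 (4 ^ j) = (1 / 2) ^ j * (pi / 2)"
      using suminf_finite[of "{j}" "\<lambda>k. f k \<bullet> cos_L2 (4 ^ j)"] by (simp add: inner)
    moreover have "K / real (4 ^ j) < (1 / 2) ^ j * (pi / 2)"
    proof -
      have "(4::real) ^ j = 2 ^ j * 2 ^ j" by (simp flip: power_mult_distrib)
      then show ?thesis using j by (simp add: field_simps power_one_over)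
    qed
    ultimately have "\<bar>suminf f \<bullet> cos_L2 (4 ^ j)\<bar> > K / real (4 ^ j)" by linarith
    then show "\<exists>n>0. \<bar>suminf f \<bullet> cos_L2 n\<bar> > K / real n" by (intro exI[of _ "4 ^ j"]) auto
  qed
qed

text \<open>
  The eigenvalue equation of the adjoint on the span of \<open>(cos, 0, 0)\<close>, \<open>(0, sin, 0)\<close>, \<open>(0, 0, cos)\<close>
  is a cubic in \<open>\<nu>\<close> that changes sign between \<open>- 1 / \<kappa>\<close> and \<open>0\<close>.
\<close>

lemma adjoint_eigenvector:
  fixes a \<gamma> \<rho>s \<mu> \<kappa> b :: real and n :: nat
  assumes pos: "\<rho>s > 0" "\<mu> > 0" "\<kappa> > 0" "b > 0" and b: "b = a * \<gamma> * \<rho>s powr (\<gamma> - 2)" and n: "n > 0"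
  obtains \<nu> r where "- 1 / \<kappa> \<le> \<nu>" "\<nu> \<le> 0"
    "\<And>z w. (z, w) \<in> system_operator a \<gamma> \<rho>s \<mu> \<kappa> \<Longrightarrow>
      w \<bullet> (cos_L2 n, (\<nu> / (b * n)) *\<^sub>R sin_L2 n, r *\<^sub>R cos_L2 n)
        = \<nu> * (z \<bullet> (cos_L2 n, (\<nu> / (b * n)) *\<^sub>R sin_L2 n, r *\<^sub>R cos_L2 n))"
proof -
  \<comment> \<open>The coefficient \<open>\<nu> / (b * n)\<close> matches the density terms,
    \<open>r \<nu>\<close> is then forced by the velocity terms, and the stress terms leave the
    equation \<open>F \<nu> = 0\<close>.\<close>
  define r where "r \<nu> = \<kappa> / \<mu> * (\<rho>s + \<nu>\<^sup>2 / (b * (real n)\<^sup>2))" for \<nu> :: real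
  define F where "F \<nu> = \<nu> / (b * \<rho>s) + (\<nu> + 1 / \<kappa>) * r \<nu>" for \<nu>
  have "\<exists>\<nu>\<ge>- 1 / \<kappa>. \<nu> \<le> 0 \<and> F \<nu> = 0"
  proof (rule IVT')
    \<comment> \<open>At \<open>- 1 / \<kappa>\<close> only the first summand of \<open>F\<close>
      survives, at 0 only the second.\<close>
    show "F (- 1 / \<kappa>) \<le> 0" "0 \<le> F 0" "- 1 / \<kappa> \<le> 0" using pos by (simp_all add: F_def r_def)
    show "continuous_on {- 1 / \<kappa>..0} F"
      unfolding F_def r_def using pos n by (intro continuous_intros) auto
  qed
  then obtain \<nu> where \<nu>: "- 1 / \<kappa> \<le> \<nu>" "\<nu> \<le> 0" "F \<nu> = 0" by blast
  have e2: "n * (\<mu> / \<kappa> * r \<nu> - \<rho>s) = \<nu> * (\<nu> / (b * n))"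
    using pos n by (simp add: r_def field_simps power2_eq_square)
  have e3: "- (\<nu> / b / \<rho>s) - r \<nu> / \<kappa> = \<nu> * r \<nu>"
    using \<nu>(3) by (simp add: F_def algebra_simps)
  show thesis
  proof (rule that[OF \<nu>(1,2), of "r \<nu>"])
    fix z w assume "(z, w) \<in> system_operator a \<gamma> \<rho>s \<mu> \<kappa>"
    then obtain \<rho> u S u' q' where zw: "z = (\<rho>, u, S)"
        "w = (- (\<rho>s *\<^sub>R u'), q', (\<mu> / \<kappa>) *\<^sub>R u' - (1 / \<kappa>) *\<^sub>R S)"
      and u: "u \<in> H1_0" "has_weak_derivative u u'"
      and q: "has_weak_derivative (- (b *\<^sub>R \<rho>) + (1 / \<rho>s) *\<^sub>R S) q'"
      unfolding system_operator_def Let_def b[symmetric] by blast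
    let ?c = "cos_L2 n" and ?s = "sin_L2 n"
    have u': "u' \<bullet> ?c = n * (u \<bullet> ?s)" by (rule H1_0_inner_cos_L2[OF u n])
    have q': "q' \<bullet> ?s = n * (b * (\<rho> \<bullet> ?c) - (S \<bullet> ?c) / \<rho>s)"
      unfolding inner_sin_L2_weak_derivative[OF q]
      by (simp add: inner_add_left algebra_simps)
    have "w \<bullet> (?c, (\<nu> / (b * n)) *\<^sub>R ?s, r \<nu> *\<^sub>R ?c)
        = \<nu> / (b * n) * (n * (b * (\<rho> \<bullet> ?c) - (S \<bullet> ?c) / \<rho>s))
          + (\<mu> / \<kappa> * r \<nu> - \<rho>s) * (n * (u \<bullet> ?s)) - r \<nu> / \<kappa> * (S \<bullet> ?c)"
      by (simp add: zw u' q' inner_diff_left inner_add_left algebra_simps)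
    also have "\<dots> = \<nu> * (\<rho> \<bullet> ?c) + n * (\<mu> / \<kappa> * r \<nu> - \<rho>s) * (u \<bullet> ?s)
          + (- (\<nu> / b / \<rho>s) - r \<nu> / \<kappa>) * (S \<bullet> ?c)"
      using pos n by (simp add: field_simps)
    also have "\<dots> = \<nu> * (z \<bullet> (?c, (\<nu> / (b * n)) *\<^sub>R ?s, r \<nu> *\<^sub>R ?c))"
      unfolding e2 e3 by (simp add: zw algebra_simps)
    finally show "w \<bullet> (?c, (\<nu> / (b * n)) *\<^sub>R ?s, r \<nu> *\<^sub>R ?c)
        = \<nu> * (z \<bullet> (?c, (\<nu> / (b * n)) *\<^sub>R ?s, r \<nu> *\<^sub>R ?c))" .
  qed
qed

section \<open>The bound that a null control imposes on the initial density\<close>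

lemma controls_integrable_norm:
  assumes "f \<in> controls T A"
  shows "integrable (lebesgue_on {0..T}) (\<lambda>t. norm (f t))"
proof (rule Bochner_Integration.integrable_bound)
  interpret finite_measure "lebesgue_on {0..T}" by (rule finite_measure_lebesgue_on) simp
  show "integrable (lebesgue_on {0..T}) (\<lambda>t. 1 + (norm (f t))\<^sup>2)"
    using assms by (auto simp: controls_def)
  show "(\<lambda>t. norm (f t)) \<in> borel_measurable (lebesgue_on {0..T})"
    using assms by (auto simp: controls_def)
  show "AE t in lebesgue_on {0..T}. norm (norm (f t)) \<le> norm (1 + (norm (f t))\<^sup>2)"
  proof (rule AE_I2)
    fix t
    have "norm (f t) \<le> 1 + (norm (f t))\<^sup>2"
      using sum_squares_bound[of 1 "norm (f t)"] by (simp add: field_simps) (smt (verit) norm_ge_zero)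
    then show "norm (norm (f t)) \<le> norm (1 + (norm (f t))\<^sup>2)" by simp
  qed
qed

text \<open>Pairing the final state 0 with the eigenvector balances \<open>exp (\<nu> * T)\<close>
  times the cosine coefficient of \<rho> against an integral of the control weighted by
  \<open>\<nu> / (b * n)\<close>. As \<nu> stays in \<open>[- 1 / \<kappa>, 0]\<close>, every factor
  is bounded uniformly in \<open>n\<close> apart from the gain \<open>1 / n\<close>.\<close>

lemma null_controlled_cos_coefficients:
  fixes a \<gamma> \<rho>s \<mu> \<kappa> b T :: real and S :: "real \<Rightarrow> state \<Rightarrow> state" and n :: nat
  assumes pos: "\<rho>s > 0" "\<mu> > 0" "\<kappa> > 0" "b > 0" "T > 0"
    and b: "b = a * \<gamma> * \<rho>s powr (\<gamma> - 2)"
    and S: "C0_semigroup S" and gen: "generator S = system_operator a \<gamma> \<rho>s \<mu> \<kappa>"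
    and f: "f \<in> controls T A"
    and mild: "mild_solution S (\<lambda>t. (0, cutoff A (f t), 0)) (\<rho>, 0, 0) T = 0"
    and n: "n > 0"
  shows "\<bar>\<rho> \<bullet> cos_L2 n\<bar> \<le> exp (T / \<kappa>) / (\<kappa> * b) * sqrt pi * (LINT t|lebesgue_on {0..T}. norm (f t)) / n"
proof -
  let ?M = "lebesgue_on {0..T}"
  define N where "N = (LINT t|?M. norm (f t))"
  obtain \<nu> r where \<nu>: "- 1 / \<kappa> \<le> \<nu>" "\<nu> \<le> 0"
    and eig: "\<And>z w. (z, w) \<in> system_operator a \<gamma> \<rho>s \<mu> \<kappa> \<Longrightarrow>
      w \<bullet> (cos_L2 n, (\<nu> / (b * n)) *\<^sub>R sin_L2 n, r *\<^sub>R cos_L2 n)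
        = \<nu> * (z \<bullet> (cos_L2 n, (\<nu> / (b * n)) *\<^sub>R sin_L2 n, r *\<^sub>R cos_L2 n))"
    using adjoint_eigenvector[OF pos(1-4) b n] by blast
  define \<psi> where "\<psi> = (cos_L2 n, (\<nu> / (b * n)) *\<^sub>R sin_L2 n, r *\<^sub>R cos_L2 n)"
  define C where "C = 1 / (\<kappa> * b * n) * sqrt pi"
  have \<nu>_bound: "\<bar>\<nu> / (b * n)\<bar> \<le> 1 / (\<kappa> * b * n)"
    using \<nu> pos n by (simp add: abs_div_pos field_simps)
  have C: "C \<ge> 0" using pos n by (simp add: C_def)
  have S_eig: "S t z \<bullet> \<psi> = exp (\<nu> * t) * (z \<bullet> \<psi>)" if "t \<ge> 0" for t z
    by (rule C0_semigroup_eigenfunctional[OF S bounded_linear_inner_left _ that])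
       (use eig gen in \<open>simp add: \<psi>_def\<close>)
  define g where "g s = S (T - s) (0, cutoff A (f s), 0)" for s
  have g_bound: "AE s in ?M. norm (g s \<bullet> \<psi>) \<le> C * norm (f s)"
  proof -
    have "AE s in ?M. cutoff A (f s) = f s" using f by (simp add: controls_def)
    moreover have "AE s in ?M. s \<in> {0..T}" by (rule AE_I2) simp
    ultimately show ?thesis
    proof eventually_elim
      case (elim s)
      have "g s \<bullet> \<psi> = exp (\<nu> * (T - s)) * (\<nu> / (b * n) * (f s \<bullet> sin_L2 n))"
        using elim by (simp add: g_def S_eig) (simp add: \<psi>_def)
      then have "norm (g s \<bullet> \<psi>) = exp (\<nu> * (T - s)) * (\<bar>\<nu> / (b * n)\<bar> * \<bar>f s \<bullet> sin_L2 n\<bar>)"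
        by (simp add: abs_mult)
      also have "\<dots> \<le> 1 * (1 / (\<kappa> * b * n) * (norm (f s) * sqrt pi))"
      proof (intro mult_mono \<nu>_bound)
        show "exp (\<nu> * (T - s)) \<le> 1" using \<nu> elim by (simp add: mult_nonpos_nonneg)
        show "\<bar>f s \<bullet> sin_L2 n\<bar> \<le> norm (f s) * sqrt pi"
          using Cauchy_Schwarz_ineq2[of "f s" "sin_L2 n"]
            mult_left_mono[OF norm_sin_L2_le[of n] norm_ge_zero[of "f s"]] by linarith
      qed (use pos n in auto)
      finally show ?case by (simp add: C_def mult_ac)
    qed
  qed
  have "\<bar>(LINT s|?M. g s) \<bullet> \<psi>\<bar> \<le> C * N"
  proof (cases "integrable ?M g")
    case True
    then have int: "integrable ?M (\<lambda>s. g s \<bullet> \<psi>)" by simp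
    have "\<bar>(LINT s|?M. g s) \<bullet> \<psi>\<bar> = norm (LINT s|?M. g s \<bullet> \<psi>)"
      using True by simp
    also have "\<dots> \<le> (LINT s|?M. norm (g s \<bullet> \<psi>))" by (rule integral_norm_bound)
    also have "\<dots> \<le> (LINT s|?M. C * norm (f s))"
      using int controls_integrable_norm[OF f] g_bound by (intro integral_mono_AE) auto
    also have "\<dots> = C * N" by (simp add: N_def)
    finally show ?thesis .
  next
    case False \<comment> \<open>then the integral in the mild solution is the junk value \<open>0\<close>\<close>
    then show ?thesis using C by (simp add: not_integrable_integral_eq N_def)
  qed
  \<comment> \<open>The initial velocity and stress are 0, so only the density component of
    \<open>\<psi>\<close> meets the initial state.\<close>
  moreover have "exp (\<nu> * T) * (\<rho> \<bullet> cos_L2 n) + (LINT s|?M. g s) \<bullet> \<psi> = 0"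
  proof -
    have "(S T (\<rho>, 0, 0) + (LINT s|?M. g s)) \<bullet> \<psi> = 0"
      using mild by (simp add: mild_solution_def g_def)
    then show ?thesis using pos by (simp add: inner_add_left S_eig) (simp add: \<psi>_def)
  qed
  ultimately have "\<bar>exp (\<nu> * T) * (\<rho> \<bullet> cos_L2 n)\<bar> \<le> C * N" by linarith
  then have *: "exp (\<nu> * T) * \<bar>\<rho> \<bullet> cos_L2 n\<bar> \<le> C * N" by (simp add: abs_mult)
  \<comment> \<open>The lower bound on \<nu> keeps \<open>exp (\<nu> * T)\<close> away from 0
    independently of \<open>n\<close>.\<close>
  have "- (T / \<kappa>) \<le> \<nu> * T" using mult_right_mono[OF \<nu>(1), of T] pos by simp
  then have "exp (- (T / \<kappa>)) * \<bar>\<rho> \<bullet> cos_L2 n\<bar> \<le> C * N"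
    using * mult_right_mono[of "exp (- (T / \<kappa>))" "exp (\<nu> * T)" "\<bar>\<rho> \<bullet> cos_L2 n\<bar>"] by simp
  then have "\<bar>\<rho> \<bullet> cos_L2 n\<bar> \<le> exp (T / \<kappa>) * (C * N)"
    by (simp add: exp_minus field_simps)
  then show ?thesis by (simp add: C_def N_def mult_ac)
qed

theorem theorem1p5:
  fixes a \<gamma> \<rho>s \<mu> \<kappa> T :: real and O2 :: "real set" and S :: "real \<Rightarrow> state \<Rightarrow> state"
  assumes "a > 0" and "\<gamma> \<ge> 1" and "\<rho>s > 0" and "\<mu> > 0" and "\<kappa> > 0"
    and "C0_semigroup S" and "generator S = system_operator a \<gamma> \<rho>s \<mu> \<kappa>"
    and "open O2" and "O2 \<subseteq> {0<..<pi}"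
    and "T > 0"
  shows "\<not> null_controllable S O2 (L2_mean_zero \<times> UNIV \<times> L2_mean_zero) T"
proof
  assume nc: "null_controllable S O2 (L2_mean_zero \<times> UNIV \<times> L2_mean_zero) T"
  obtain \<rho> where \<rho>: "\<rho> \<in> L2_mean_zero" "\<And>K. \<exists>n>0. \<bar>\<rho> \<bullet> cos_L2 n\<bar> > K / real n"
    using ex_mean_zero_slow_cos_coefficients by blast
  have "0 \<in> L2_mean_zero" by (rule L2_mean_zeroI) simp
  then obtain f where f: "f \<in> controls T O2"
    "mild_solution S (\<lambda>t. (0, cutoff O2 (f t), 0)) (\<rho>, 0, 0) T = 0"
    using nc \<rho>(1) unfolding null_controllable_def by blast
  define b where "b = a * \<gamma> * \<rho>s powr (\<gamma> - 2)"
  have "b > 0" using assms by (simp add: b_def)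
  \<comment> \<open>\<open>K\<close> depends on the control \<open>f\<close> but not on
    \<open>n\<close>, and \<open>f\<close> is fixed before \<open>n\<close> is chosen.\<close>
  define K where "K = exp (T / \<kappa>) / (\<kappa> * b) * sqrt pi * (LINT t|lebesgue_on {0..T}. norm (f t))"
  obtain n where n: "n > 0" "\<bar>\<rho> \<bullet> cos_L2 n\<bar> > K / real n" using \<rho>(2) by blast
  moreover have "\<bar>\<rho> \<bullet> cos_L2 n\<bar> \<le> K / real n"
    unfolding K_def
    by (rule null_controlled_cos_coefficients[OF assms(3-5) \<open>b > 0\<close> assms(10) b_def assms(6,7) f n(1)])
  ultimately show False by linarith
qed

end
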